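(* Let $n \ge 1$ and let $\|\cdot\|$ be a norm on $\mathbb{R}^n$ which is unconditional, i.e. $$\|(\epsilon_1 x_1, \ldots, \epsilon_n x_n)\| = \|(x_1,\ldots,x_n)\|$$ for any $x_j \in \mathbb{R}$ and $\epsilon_j \in \{-1,1\}$. Let $\mu$ be a Borel probability measure on $\mathbb{R}$ and suppose that the product measure $\mu^n = \mu^{\otimes n}$ supports the S-inequality for all ideals in $\mathbb{R}^n$. Then for $p \ge q > 0$ $$\left( \int_{\mathbb{R}^n} \|x\|^p \,\mathrm{d}\mu^n(x) \right)^{1/p} \le C_{p,q} \left( \int_{\mathbb{R}^n} \|x\|^q \,\mathrm{d}\mu^n(x) \right)^{1/q},$$ where the constant $$C_{p,q} = \frac{\left( \int_{\mathbb{R}} |x|^p\,\mathrm{d}\mu(x) \right)^{1/p}}{\left( \int_{\mathbb{R}} |x|^q\,\mathrm{d}\mu(x) \right)^{1/q}}$$ is the best possible (i.e. it cannot be replaced by a smaller constant valid for all unconditional norms). In particular, one may take $\mu = \nu_r$ for $r \in (0,1]$, $\mu = \omega_\alpha$ for $\alpha > 0$, or $\mu = \lambda_s$ for $s \ge 1$, where $$\mathrm{d}\nu_r(x) = \frac{1}{2\Gamma(1+1/r)} e^{-|x|^r}\,\mathrm{d}x, \quad \mathrm{d}\omega_\alpha(x) = \frac{1}{2}\alpha|x|^{\alpha-1}e^{-|x|^\alpha}\,\mathrm{d}x, \quad \mathrm{d}\lambda_s(x) = \frac{1}{2\Gamma(s)}|x|^{s-1}e^{-|x|}\,\mathrm{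d}x.$$
   Context: A product measure $\mu^n = \mu^{\otimes n}$ on $\mathbb{R}^n$ supports the S-inequality for a Borel set $L \subset \mathbb{R}^n$ if for any dilation $K = sL$, $s>0$, and any strip $P = \{x \in \mathbb{R}^n : |x_1| \le w\}$ (with $w \ge 0$) we have $$\mu^n(K) = \mu^n(P) \quad\Longrightarrow\quad \mu^n(tK) \ge \mu^n(tP) \ \text{ for all } t \ge 1.$$ A set $K \subset \mathbb{R}^n$ is called an ideal if along with each of its points $x \in K$ it contains the cube $[-|x_1|,|x_1|] \times \cdots \times [-|x_n|,|x_n|]$. "Supports the S-inequality for all ideals" means for every Borel set that is an ideal. *)

theory Defs
  imports "HOL-Probability.Probability"
begin

definition power_measure :: "real measure \<Rightarrow> (real ^ 'n) measure" where
  "power_measure \<mu> = distr (\<Pi>\<^sub>M i\<in>(UNIV :: 'n set). \<mu>) borel (\<lambda>f. \<chi> i. f i)"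

definition dilate :: "real \<Rightarrow> (real ^ 'n) set \<Rightarrow> (real ^ 'n) set" where
  "dilate t K = (\<lambda>x. t *\<^sub>R x) ` K"

text \<open>The index type carries no canonical first element, so the coordinate playing the role of
  \<open>x\<^sub>1\<close> is an explicit parameter \<open>j\<close>.\<close>

definition strip :: "'n \<Rightarrow> real \<Rightarrow> (real ^ 'n) set" where
  "strip j w = {x. \<bar>x $ j\<bar> \<le> w}"

definition supports_S_inequality :: "'n \<Rightarrow> (real ^ 'n) measure \<Rightarrow> (real ^ 'n) set \<Rightarrow> bool" where
  "supports_S_inequality j M L \<longleftrightarrow>
    (\<forall>s>0. \<forall>w\<ge>0. measure M (dilate s L) = measure M (strip j w) \<longrightarrow>
      (\<forall>t\<ge>1. measure M (dilate t (dilate s L)) \<ge> measure M (dilate t (strip j w))))"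

definition is_ideal :: "(real ^ 'n) set \<Rightarrow> bool" where
  "is_ideal K \<longleftrightarrow> (\<forall>x\<in>K. cbox (\<chi> i. - \<bar>x $ i\<bar>) (\<chi> i. \<bar>x $ i\<bar>) \<subseteq> K)"

definition supports_S_inequality_ideals :: "'n \<Rightarrow> (real ^ 'n) measure \<Rightarrow> bool" where
  "supports_S_inequality_ideals j M \<longleftrightarrow>
    (\<forall>L \<in> sets borel. is_ideal L \<longrightarrow> supports_S_inequality j M L)"

definition is_norm :: "('a :: real_vector \<Rightarrow> real) \<Rightarrow> bool" where
  "is_norm N \<longleftrightarrow> (\<forall>x. 0 \<le> N x) \<and> (\<forall>x. N x = 0 \<longleftrightarrow> x = 0) \<and>
    (\<forall>a x. N (a *\<^sub>R x) = \<bar>a\<bar> * N x) \<and> (\<forall>x y. N (x + y) \<le> N x + N y)"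

definition unconditional :: "(real ^ 'n \<Rightarrow> real) \<Rightarrow> bool" where
  "unconditional N \<longleftrightarrow>
    (\<forall>x \<epsilon>. (\<forall>i. \<epsilon> i \<in> {-1, 1}) \<longrightarrow> N (\<chi> i. \<epsilon> i * x $ i) = N x)"

text \<open>Moments are extended nonnegative reals, so that divergent integrals have value \<open>\<infinity>\<close>.
  The real power is extended by \<open>\<infinity>\<^sup>a = \<infinity>\<close>; it is meant for exponents \<open>a > 0\<close>.\<close>

definition ennreal_powr :: "ennreal \<Rightarrow> real \<Rightarrow> ennreal" where
  "ennreal_powr x a = (if x = \<infinity> then \<infinity> else ennreal (enn2real x powr a))"

definition moment :: "'a measure \<Rightarrow> ('a \<Rightarrow> real) \<Rightarrow> real \<Rightarrow> ennreal" where
  "moment M f p = (\<integral>\<^sup>+ x. ennreal (f x powr p) \<partial>M)"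

text \<open>Used only when the \<open>q\<close>-th moment is finite. If it is zero (\<open>\<mu>\<close> a point mass at the origin),
  the constant is \<open>0 / 0 = 0\<close>.\<close>

definition moment_constant :: "real measure \<Rightarrow> real \<Rightarrow> real \<Rightarrow> ennreal" where
  "moment_constant \<mu> p q =
    ennreal_powr (moment \<mu> abs p) (1 / p) / ennreal_powr (moment \<mu> abs q) (1 / q)"

definition nu :: "real \<Rightarrow> real measure" where
  "nu r = density lborel (\<lambda>x. ennreal (1 / (2 * Gamma (1 + 1 / r)) * exp (- (\<bar>x\<bar> powr r))))"

definition omega :: "real \<Rightarrow> real measure" where
  "omega \<alpha> = density lborel
    (\<lambda>x. ennreal (1 / 2 * \<alpha> * \<bar>x\<bar> powr (\<alpha> - 1) * exp (- (\<bar>x\<bar> powr \<alpha>))))"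

definition lam :: "real \<Rightarrow> real measure" where
  "lam s = density lborel
    (\<lambda>x. ennreal (1 / (2 * Gamma s) * \<bar>x\<bar> powr (s - 1) * exp (- \<bar>x\<bar>)))"

end

theory Submission
  imports Defs
begin

text \<open>If \<open>\<bar>X\<bar>\<^sup>r\<close> has a Gamma law of shape \<open>s \<ge> 1\<close> with tail \<open>T\<close>, then strips satisfy
  \<open>\<mu> (\<tau> P)\<^sup>c = T (t z)\<close> with \<open>t = \<tau>\<^sup>r\<close> and \<open>T z = \<mu> P\<^sup>c\<close>; put \<open>R = R\<^sub>t\<close> with \<open>R (T z) = T (t z)\<close>. The claim
  \<open>\<mu>\<^sup>n (\<tau> K)\<^sup>c \<le> R (\<mu>\<^sup>n K\<^sup>c)\<close> for ideals follows by induction on \<open>n\<close>: slicing \<open>K\<close> along one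
  coordinate reduces it to \<open>E (R (h (X / \<tau>))) \<le> R (E (h X))\<close> for functions \<open>h\<close> increasing in \<open>\<bar>x\<bar>\<close>. There
  is equality for indicators of \<open>{x. a \<le> \<bar>x\<bar>}\<close>, of which \<open>h\<close> is a mixture, so it suffices that the
  quasi-arithmetic mean defined by \<open>R\<close> is convex. By Hardy, Littlewood and Polya this amounts to
  concavity of \<open>R' / R''\<close>, which is here a multiple of the Gamma density as a function of its tail, and
  so to log-concavity of that density. The three families correspond to the shapes \<open>s = 1 / r\<close> for
  \<open>nu r\<close>, \<open>s = 1\<close> for \<open>omega \<alpha>\<close> and \<open>s\<close> for \<open>lam s\<close>.

  For the moments, the S-inequality for the balls of a norm says that the tails of \<open>N X\<close> and of
  \<open>c \<bar>X\<^sub>1\<bar>\<close> cross at most once. The norms \<open>\<bar>x\<^sub>j\<bar> + \<epsilon> \<Sum>\<bar>x\<^sub>i\<bar>\<close> show that the constant is optimal.\<close>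

section \<open>Gamma tails\<close>

text \<open>For shape 1 the Gamma density jumps at 0, so the tail is not differentiable there. The
  fundamental theorem of calculus tolerates finitely many such points and gives the increment of
  \<open>f\<close> as the integral of a nonnegative function.\<close>

lemma nondecreasing_off_finite:
  fixes f f' :: "real \<Rightarrow> real"
  assumes "finite S" "a \<le> b" "continuous_on {a..b} f"
    and "\<And>x. a < x \<Longrightarrow> x < b \<Longrightarrow> x \<notin> S \<Longrightarrow> (f has_real_derivative f' x) (at x)"
    and "\<And>x. a < x \<Longrightarrow> x < b \<Longrightarrow> 0 \<le> f' x"
  shows "f a \<le> f b"
proof -
  have "(f' has_integral (f b - f a)) {a..b}"
    by (rule fundamental_theorem_of_calculus_interior_strong[OF assms(1,2)])
      (use assms in \<open>auto simp: has_real_derivative_iff_has_vector_derivative[symmetric]\<close>)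
  \<comment> \<open>The sign of \<open>f'\<close> is known only in the open interval; the values at
    the two end points do not affect the integral.\<close>
  then have "((\<lambda>x. if x = a \<or> x = b then 0 else f' x) has_integral (f b - f a)) {a..b}"
    by (rule has_integral_spike_finite[of "{a, b}", rotated 2]) auto
  then have "0 \<le> f b - f a"
    by (rule has_integral_nonneg) (use assms(5) in force)
  then show ?thesis by simp
qed

locale gamma_shape =
  fixes s :: real
  assumes s_ge_1: "1 \<le> s"
begin

definition dens :: "real \<Rightarrow> real" where
  "dens x = (if 0 < x then x powr (s - 1) * exp (- x) / Gamma s else 0)"

text \<open>For negative \<open>x\<close> the interval is empty, so the Gamma tail is extended by
  the constant 1. Shifted arguments below may leave the half-line.\<close>

definition tail :: "real \<Rightarrow> real" where
  "tail x = 1 - integral {0..x} dens"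

lemma Gamma_s_pos: "0 < Gamma s"
  using s_ge_1 by (intro Gamma_real_pos) simp

lemma dens_nonneg: "0 \<le> dens x"
  using Gamma_s_pos by (simp add: dens_def)

lemma dens_pos: "0 < x \<Longrightarrow> 0 < dens x"
  using Gamma_s_pos by (simp add: dens_def)

lemma measurable_dens [measurable]: "dens \<in> borel_measurable borel"
  unfolding dens_def by measurable

lemma dens_has_integral: "(dens has_integral 1) {0..}"
proof -
  have "((\<lambda>x. x powr (s - 1) / exp x / Gamma s) has_integral Gamma s / Gamma s) {0..}"
    using Gamma_integral_real[of s] s_ge_1 by (intro has_integral_divide) auto
  then have "((\<lambda>x. x powr (s - 1) / exp x / Gamma s) has_integral 1) {0..}"
    using Gamma_s_pos by simp
  then show ?thesis
    by (rule has_integral_eq[rotated]) (auto simp: dens_def exp_minus field_simps)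
qed

lemma dens_integrable_on [simp]: "dens integrable_on {a..b}"
proof -
  have "(dens has_integral 1) UNIV"
    using has_integral_on_superset[OF dens_has_integral, of UNIV] by (auto simp: dens_def)
  then show ?thesis
    by (metis has_integral_integrable integrable_on_subinterval top_greatest)
qed

lemma tail_nonpos [simp]: "x \<le> 0 \<Longrightarrow> tail x = 1"
  by (cases "x = 0") (auto simp: tail_def)

lemma tail_has_derivative:
  assumes "x \<noteq> 0"
  shows "(tail has_real_derivative - dens x) (at x)"
proof (cases "0 < x")
  case True
  have cont: "isCont dens x"
  proof -
    have "isCont (\<lambda>x. x powr (s - 1) * exp (- x) / Gamma s) x"
      using True Gamma_s_pos by (intro continuous_intros) auto
    moreover have "\<forall>\<^sub>F y in nhds x. dens y = y powr (s - 1) * exp (- y) / Gamma s"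
      using True by (auto simp: dens_def eventually_nhds intro!: exI[of _ "{0<..}"])
    ultimately show ?thesis
      by (rule isCont_cong[THEN iffD2, rotated])
  qed
  have "((\<lambda>u. integral {0..u} dens) has_vector_derivative dens x) (at x within {0..x + 1} - {})"
    by (rule integral_has_vector_derivative_continuous_at)
      (use True cont in \<open>auto intro: continuous_at_imp_continuous_at_within\<close>)
  then have "((\<lambda>u. integral {0..u} dens) has_real_derivative dens x) (at x within {0..x + 1})"
    by (simp add: has_real_derivative_iff_has_vector_derivative)
  moreover have "at x within {0..x + 1} = at x"
    using True by (intro at_within_interior) auto
  ultimately have "((\<lambda>u. integral {0..u} dens) has_real_derivative dens x) (at x)"
    by simp
  then have "((\<lambda>u. 1 - integral {0..u} dens) has_real_derivative 0 - dens x) (at x)"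
    by (intro derivative_intros)
  then show ?thesis by (simp add: tail_def [abs_def])
next
  case False
  with assms have "x < 0" by simp
  have "((\<lambda>x::real. 1) has_real_derivative 0) (at x)" by simp
  then have "(tail has_real_derivative 0) (at x)"
    by (rule DERIV_cong_ev[THEN iffD1, rotated -1])
      (use \<open>x < 0\<close> in \<open>auto simp: eventually_nhds intro!: exI[of _ "{..<0}"]\<close>)
  then show ?thesis using \<open>x < 0\<close> by (simp add: dens_def)
qed

lemma continuous_tail: "continuous_on A tail"
proof -
  have c: "continuous_on {0..b} tail" for b
    unfolding tail_def by (intro continuous_intros indefinite_integral_continuous_1) simp
  have "isCont tail x" for x
  proof (cases "x = 0")
    case True
    have "continuous_on ({-1..0} \<union> {0..1}) tail"
      by (intro continuous_on_closed_Un c continuous_on_eq[OF continuous_on_const[of _ 1]]) auto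
    then have "continuous_on {-1..1} tail"
      by (simp add: ivl_disj_un_two_touch)
    then show ?thesis using True by (intro continuous_on_interior[of "{-1..1}"]) auto
  next
    case False
    then show ?thesis using tail_has_derivative DERIV_isCont by blast
  qed
  then show ?thesis by (simp add: continuous_at_imp_continuous_on)
qed

lemmas continuous_tail' [continuous_intros] =
  continuous_on_compose2[OF continuous_tail[of UNIV] _ subset_UNIV]

lemma tail_antimono:
  assumes "x \<le> y"
  shows "tail y \<le> tail x"
proof -
  have "- tail x \<le> - tail y"
    by (rule nondecreasing_off_finite[of "{0}" _ _ _ dens])
      (use assms in \<open>auto intro!: continuous_intros derivative_eq_intros tail_has_derivative
        simp: dens_nonneg\<close>)
  then show ?thesis by simp
qed

lemma tail_tendsto_0: "(tail \<longlongrightarrow> 0) at_top"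
proof -
  have i: "(dens has_integral 1) UNIV"
    using has_integral_on_superset[OF dens_has_integral, of UNIV] by (auto simp: dens_def)
  have nn: "(\<integral>\<^sup>+ x. ennreal (dens x) \<partial>lborel) = 1"
    using nn_integral_has_integral_lborel[OF measurable_dens dens_nonneg i] by simp
  have int: "integrable lborel dens"
    by (rule integrableI_nonneg) (auto simp: nn dens_nonneg)
  have 1: "(\<integral>x. dens x \<partial>lborel) = 1"
    using nn by (simp add: integral_eq_nn_integral dens_nonneg)
  have "(\<integral>u. indicator {..x} u *\<^sub>R dens u \<partial>lborel) = 1 - tail x" for x
  proof -
    have "(\<integral>u. indicator {..x} u *\<^sub>R dens u \<partial>lborel) = (LINT u:{0..x}|lborel. dens u)"
      unfolding set_lebesgue_integral_def
      by (intro Bochner_Integration.integral_cong) (auto simp: indicator_def dens_def)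
    also have "\<dots> = integral {0..x} dens"
      using integrable_mult_indicator[OF _ int, of "{0..x}"]
      by (intro set_borel_integral_eq_integral) (simp add: set_integrable_def)
    finally show ?thesis by (simp add: tail_def)
  qed
  then have "((\<lambda>x. 1 - tail x) \<longlongrightarrow> 1) at_top"
    using tendsto_integral_at_top[of lborel dens] int 1 by simp
  from tendsto_diff[OF tendsto_const[of 1] this] show ?thesis by simp
qed

lemma tail_nonneg: "0 \<le> tail x"
  by (rule tendsto_upperbound[OF tail_tendsto_0])
    (auto intro!: eventually_at_top_linorderI[of x] tail_antimono)

lemma tail_le_1: "tail x \<le> 1"
  using tail_antimono[of "min x 0" x] by simp

lemma tail_strict_antimono:
  assumes "0 \<le> x" "x < y"
  shows "tail y < tail x"
proof (rule DERIV_neg_imp_decreasing_open[OF assms(2)])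
  fix u assume "x < u" "u < y"
  then show "\<exists>l. (tail has_real_derivative l) (at u) \<and> l < 0"
    using assms tail_has_derivative[of u] dens_pos[of u] by (intro exI[of _ "- dens u"]) auto
qed (rule continuous_tail)

lemma tail_pos: "0 < tail x"
proof -
  have "tail (max x 0 + 1) < tail (max x 0)" by (rule tail_strict_antimono) auto
  also have "tail (max x 0) = tail x" by (simp add: max_def)
  finally show ?thesis using tail_nonneg[of "max x 0 + 1"] by simp
qed

lemma tail_less_iff: "0 \<le> x \<Longrightarrow> 0 \<le> y \<Longrightarrow> tail x < tail y \<longleftrightarrow> y < x"
  by (metis linorder_not_less tail_antimono tail_strict_antimono)

lemma tail_le_iff: "0 \<le> x \<Longrightarrow> 0 \<le> y \<Longrightarrow> tail x \<le> tail y \<longleftrightarrow> y \<le> x"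
  by (metis linorder_not_less tail_less_iff)

lemma tail_surj:
  assumes "0 < u" "u \<le> 1"
  obtains x where "0 \<le> x" "tail x = u"
proof -
  have "\<forall>\<^sub>F x in at_top. tail x < u \<and> 0 \<le> x"
    using order_tendstoD(2)[OF tail_tendsto_0 assms(1)] eventually_ge_at_top[of 0]
    by eventually_elim simp
  then obtain b where "tail b < u" "0 \<le> b"
    using eventually_happens by fastforce
  then show ?thesis
    using IVT2'[of tail b u 0] assms continuous_tail that by auto
qed

text \<open>Log-concavity of the density: when the sums agree, so do the exponential factors, and
  the product of two densities grows with the product of the arguments because \<open>s - 1\<close>
  is nonnegative.\<close>

lemma dens_mult_mono:
  assumes "0 < x'" "0 < y'" "x + y = x' + y'" "x * y \<le> x' * y'"
  shows "dens x * dens y \<le> dens x' * dens y'"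
proof (cases "0 < x \<and> 0 < y")
  case True
  have eq: "dens a * dens b = (a * b) powr (s - 1) * exp (- (a + b)) / (Gamma s)\<^sup>2"
    if "0 < a" "0 < b" for a b
    using that by (simp add: dens_def powr_mult exp_add power2_eq_square exp_diff field_simps exp_minus)
  have "(x * y) powr (s - 1) \<le> (x' * y') powr (s - 1)"
    using True assms s_ge_1 by (intro powr_mono2) auto
  then show ?thesis
    using True assms(1,2) unfolding eq[OF assms(1,2)] assms(3)[symmetric]
    by (simp add: eq divide_right_mono mult_right_mono)
next
  case False
  then have "dens x = 0 \<or> dens y = 0" by (auto simp: dens_def)
  then show ?thesis by (auto simp: dens_nonneg)
qed

text \<open>Log-concavity of the density makes \<open>(tail b - tail (b + d)) / dens b\<close> antitone in \<open>b\<close>.\<close>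

lemma tail_increment_ratio:
  assumes "0 < b" "b \<le> b'"
  shows "dens b * (tail b' - tail (b' + d)) \<le> dens b' * (tail b - tail (b + d))"
proof -
  \<comment> \<open>The difference of the two sides as a function of the increment. It vanishes at
    0, and log-concavity makes it nonincreasing before 0 and nondecreasing after 0.\<close>
  define W where "W r = dens b' * (tail b - tail (b + r)) - dens b * (tail b' - tail (b' + r))" for r
  have cont: "continuous_on A W" for A
    unfolding W_def by (intro continuous_intros)
  have deriv: "(W has_real_derivative dens b' * dens (b + r) - dens b * dens (b' + r)) (at r)"
    if "r \<notin> {- b, - b'}" for r :: real
    unfolding W_def using that
    by (auto intro!: derivative_eq_intros DERIV_chain2[OF tail_has_derivative])
  have "W 0 \<le> W d" if "0 \<le> d"
  proof (rule nondecreasing_off_finite[of "{- b, - b'}", OF _ that cont deriv])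
    fix r :: real assume "0 < r"
    then show "0 \<le> dens b' * dens (b + r) - dens b * dens (b' + r)"
      using dens_mult_mono[of b' "b + r" b "b' + r"] assms mult_right_mono[of b b' r]
      by (auto simp: algebra_simps)
  qed auto
  moreover have "- W d \<le> - W 0" if "d \<le> 0"
  proof (rule nondecreasing_off_finite[of "{- b, - b'}" d 0 "\<lambda>r. - W r", OF _ that])
    show "((\<lambda>r. - W r) has_real_derivative - (dens b' * dens (b + r) - dens b * dens (b' + r))) (at r)"
      if "r \<notin> {- b, - b'}" for r :: real
      using DERIV_minus[OF deriv[OF that]] .
    fix r :: real assume r: "r < 0"
    show "0 \<le> - (dens b' * dens (b + r) - dens b * dens (b' + r))"
    proof (cases "0 < b + r")
      case True
      with r assms show ?thesis
        using dens_mult_mono[of b "b' + r" b' "b + r"] mult_right_mono_neg[of b b' r]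
        by (auto simp: algebra_simps)
    next
      case False
      then have "dens (b + r) = 0" by (simp add: dens_def)
      then show ?thesis by (simp add: dens_nonneg)
    qed
  qed (auto intro!: continuous_intros cont)
  ultimately show ?thesis by (cases "0 \<le> d") (auto simp: W_def)
qed

end

section \<open>The rescaled tail as a convex function of the tail, and its tangent planes\<close>

locale gamma_scaled = gamma_shape +
  fixes t :: real
  assumes t_gt_1: "1 < t"
begin

text \<open>This is \<open>t * dens (t * x) / dens x\<close> for positive \<open>x\<close>, hence
  the derivative of \<open>R\<close> at \<open>tail x\<close>. That it is antitone in
  \<open>x\<close> is the convexity of \<open>R\<close>.\<close>

definition rho :: "real \<Rightarrow> real" where
  "rho x = t powr s * exp (- ((t - 1) * x))"

lemma rho_pos: "0 < rho x"
  using t_gt_1 by (simp add: rho_def)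

lemma rho_antimono: "x \<le> y \<Longrightarrow> rho y \<le> rho x"
  using t_gt_1 by (auto simp: rho_def intro!: mult_left_mono)

text \<open>As \<open>rho\<close> is exponential, translating its argument amounts to multiplying it
  by a factor. This keeps the coefficient of \<open>u\<close> fixed while two points are shifted
  together.\<close>

lemma exp_mult_rho: "exp ((t - 1) * (x - y)) * rho (x + d) = rho (y + d)"
  by (simp add: rho_def exp_add[symmetric] algebra_simps)

lemma dens_scaled: "t * dens (t * x) = rho x * dens x"
proof (cases "0 < x")
  case True
  have "t * (t * x) powr (s - 1) = t powr s * x powr (s - 1)"
    using True t_gt_1 by (simp add: powr_mult powr_diff)
  moreover have "exp (- (t * x)) = exp (- ((t - 1) * x)) * exp (- x)"
    by (simp add: exp_add[symmetric] algebra_simps)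
  ultimately have "t * (t * x) powr (s - 1) * exp (- (t * x)) =
      t powr s * x powr (s - 1) * (exp (- ((t - 1) * x)) * exp (- x))"
    by simp
  then show ?thesis
    using True t_gt_1 by (simp add: dens_def rho_def mult_ac)
next
  case False
  then show ?thesis using t_gt_1 by (simp add: dens_def zero_less_mult_iff)
qed

lemma tail_scaled_has_derivative:
  assumes "x \<noteq> 0"
  shows "((\<lambda>x. tail (t * x)) has_real_derivative - (rho x * dens x)) (at x)"
proof -
  have "((\<lambda>x. tail (t * x)) has_real_derivative (- dens (t * x)) * t) (at x)"
    by (rule DERIV_chain2[OF tail_has_derivative])
      (use assms t_gt_1 in \<open>auto intro!: derivative_eq_intros\<close>)
  also have "(- dens (t * x)) * t = - (rho x * dens x)"
    using dens_scaled[of x] by (simp add: mult.commute)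
  finally show ?thesis .
qed

text \<open>Convexity of \<open>R\<close>: its tangent at \<open>tail k\<close>, evaluated at 0, is
  at most \<open>R 0 = 0\<close>. The value 0 of the tail belongs to infinity, so the difference of
  the two sides is followed from \<open>k\<close> to infinity, where it tends to 0.\<close>

lemma tail_scaled_le: "tail (t * k) \<le> rho k * tail k"
proof -
  have mono: "tail (t * k) - rho k * tail k \<le> tail (t * b) - rho k * tail b" if "k \<le> b" for b
  proof (rule nondecreasing_off_finite[of "{0}", OF _ that])
    show "((\<lambda>x. tail (t * x) - rho k * tail x) has_real_derivative (rho k - rho x) * dens x) (at x)"
      if "x \<notin> {0}" for x
      using DERIV_diff[OF tail_scaled_has_derivative DERIV_cmult[OF tail_has_derivative], of x "rho k"]
        that by (simp add: algebra_simps)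
    show "0 \<le> (rho k - rho x) * dens x" if "k < x" for x
      using rho_antimono[of k x] that by (simp add: dens_nonneg)
  qed (auto intro!: continuous_intros)
  have "((\<lambda>b. tail (t * b)) \<longlongrightarrow> 0) at_top"
    using t_gt_1 by (intro filterlim_compose[OF tail_tendsto_0]
      filterlim_tendsto_pos_mult_at_top[OF tendsto_const _ filterlim_ident]) auto
  from tendsto_diff[OF this tendsto_mult_left[OF tail_tendsto_0, of "rho k"]]
  have "((\<lambda>b. tail (t * b) - rho k * tail b) \<longlongrightarrow> 0) at_top" by simp
  then have "tail (t * k) - rho k * tail k \<le> 0"
    by (rule tendsto_lowerbound) (auto intro!: eventually_at_top_linorderI[of k] mono)
  then show ?thesis by simp
qed

text \<open>The same tangent evaluated at the other end point, where \<open>R 1 = 1\<close>. At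
  \<open>min k 0\<close> both tails equal 1; for negative \<open>k\<close> the interval of
  monotonicity is a single point.\<close>

lemma tail_scaled_ge: "rho k * (1 - tail k) \<le> 1 - tail (t * k)"
proof -
  have "rho k * tail (min k 0) - tail (t * min k 0) \<le> rho k * tail k - tail (t * k)"
  proof (rule nondecreasing_off_finite[of "{0}" _ _ "\<lambda>x. rho k * tail x - tail (t * x)"])
    show "((\<lambda>x. rho k * tail x - tail (t * x)) has_real_derivative (rho x - rho k) * dens x) (at x)"
      if "x \<notin> {0}" for x
      using DERIV_diff[OF DERIV_cmult[OF tail_has_derivative] tail_scaled_has_derivative, of x "rho k"]
        that by (simp add: algebra_simps)
    show "0 \<le> (rho x - rho k) * dens x" if "x < k" for x
      using rho_antimono[of x k] that by (simp add: dens_nonneg)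
  qed (auto intro!: continuous_intros)
  moreover have "t * min k 0 \<le> 0" using t_gt_1 by (simp add: mult_nonneg_nonpos)
  ultimately show ?thesis by (simp add: algebra_simps)
qed

text \<open>\<open>tail_tangent\<close> below is the tangent plane inequality for the jointly convex function
  \<open>(u, v) \<mapsto> (R u - R v) / R' v\<close>, where \<open>R (tail a) = tail (t * a)\<close>: it compares the values at
  \<open>(u, tail a)\<close> with the tangent plane at \<open>(tail y, tail z)\<close>, multiplied by \<open>R' (tail z) = rho z\<close>, and
  \<open>slope y z\<close> is \<open>rho z\<close> times the partial derivative in \<open>v\<close> there. Convexity of \<open>R\<close> reduces it to
  the points \<open>(tail (a + (y - z)), tail a)\<close>, at which the derivative in \<open>u\<close> stays constant.\<close>

definition slope :: "real \<Rightarrow> real \<Rightarrow> real" where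
  "slope y z = (t - 1) * (tail (t * z) - tail (t * y)) / dens z - rho z"

text \<open>Along the curve \<open>u = tail (a + (y - z))\<close>, \<open>v = tail a\<close>, where
  the derivative in \<open>u\<close> is constant, \<open>H\<close> is the convex function minus the
  linear part of its tangent plane, times \<open>rho z\<close>. The sign of its derivative compares
  the ratios \<open>(tail b - tail (b + d)) / dens b\<close> at \<open>b = t * z\<close> and
  \<open>b = t * a\<close> with \<open>d = t * (y - z)\<close>, so their monotonicity puts the
  minimum at \<open>z\<close>.\<close>

lemma tail_shift_minimum:
  fixes y z
  defines "H \<equiv> \<lambda>a. exp ((t - 1) * (a - z)) * (tail (t * (a + (y - z))) - tail (t * a))
    - rho y * tail (a + (y - z)) - slope y z * tail a"
  assumes y: "0 \<le> y" and z: "0 < z" and a: "0 \<le> a"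
  shows "H z \<le> H a"
proof -
  let ?D = "\<lambda>a. tail (t * a) - tail (t * a + t * (y - z))"
  \<comment> \<open>The terms with the density at \<open>a + (y - z)\<close> cancel because
    \<open>exp ((t - 1) * (a - z)) * rho (a + (y - z)) = rho y\<close>, and \<open>slope y z\<close>
    is the value that makes \<open>H'\<close> vanish at \<open>z\<close>.\<close>
  define H' where "H' a = (t - 1) * ((dens a * ?D z - exp ((t - 1) * (a - z)) * dens z * ?D a) / dens z)" for a
  have cont: "continuous_on A H" for A
    unfolding H_def by (intro continuous_intros)
  have deriv: "(H has_real_derivative H' a) (at a)" if "a \<noteq> 0" "a + (y - z) \<noteq> 0" for a
  proof -
    have 1: "((\<lambda>a. tail (t * (a + (y - z)))) has_real_derivative
        - (rho (a + (y - z)) * dens (a + (y - z)))) (at a)"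
      using DERIV_shift[of "\<lambda>x. tail (t * x)" _ a "y - z"]
        tail_scaled_has_derivative[OF that(2)] by simp
    have 2: "((\<lambda>a. tail (a + (y - z))) has_real_derivative - dens (a + (y - z))) (at a)"
      using DERIV_shift[of tail _ a "y - z"] tail_has_derivative[OF that(2)] by simp
    have 3: "((\<lambda>a. exp ((t - 1) * (a - z))) has_real_derivative
        (t - 1) * exp ((t - 1) * (a - z))) (at a)"
      by (auto intro!: derivative_eq_intros)
    let ?e = "exp ((t - 1) * (a - z))"
    have "(H has_real_derivative
        (t - 1) * ?e * (tail (t * (a + (y - z))) - tail (t * a))
        + ?e * (- (rho (a + (y - z)) * dens (a + (y - z))) + rho a * dens a)
        + rho y * dens (a + (y - z)) + slope y z * dens a) (at a)"
      unfolding H_def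
      by (rule derivative_eq_intros 1 2 3 tail_has_derivative tail_scaled_has_derivative that refl)+
        (simp add: algebra_simps)
    moreover have "?e * rho (a + (y - z)) = rho y" "?e * rho a = rho z"
      using exp_mult_rho[of a z "y - z"] exp_mult_rho[of a z 0] by simp_all
    moreover have "?e * (- (rho (a + (y - z)) * dens (a + (y - z))) + rho a * dens a) =
        - (?e * rho (a + (y - z)) * dens (a + (y - z))) + ?e * rho a * dens a"
      by (simp add: algebra_simps)
    ultimately show ?thesis
      using dens_pos[OF z] by (simp add: H'_def slope_def field_simps)
  qed
  \<comment> \<open>Multiplying by \<open>t\<close> and using \<open>dens_scaled\<close> turns the
    exponential weight into densities at \<open>t * z\<close> and \<open>t * a\<close>, the form in
    which \<open>tail_increment_ratio\<close> applies.\<close>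
  have sign: "exp ((t - 1) * (a - z)) * dens z * ?D a \<le> dens a * ?D z \<longleftrightarrow>
      dens (t * z) * ?D a \<le> dens (t * a) * ?D z" (is "?L \<longleftrightarrow> ?R") for a
  proof -
    have "?R \<longleftrightarrow> t * (dens (t * z) * ?D a) \<le> t * (dens (t * a) * ?D z)"
      using t_gt_1 by simp
    also have "\<dots> \<longleftrightarrow> rho z * dens z * ?D a \<le> rho a * dens a * ?D z"
      by (simp add: mult.assoc[symmetric] dens_scaled)
    also have "rho z = rho a * exp ((t - 1) * (a - z))"
      using exp_mult_rho[of a z 0] by (simp add: mult.commute)
    also have "rho a * exp ((t - 1) * (a - z)) * dens z * ?D a \<le> rho a * dens a * ?D z \<longleftrightarrow> ?L"
      using rho_pos[of a] by (simp add: mult.assoc)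
    finally show ?thesis by simp
  qed
  have sign': "dens a * ?D z \<le> exp ((t - 1) * (a - z)) * dens z * ?D a \<longleftrightarrow>
      dens (t * a) * ?D z \<le> dens (t * z) * ?D a" (is "?L \<longleftrightarrow> ?R") for a
  proof -
    have "?R \<longleftrightarrow> t * (dens (t * a) * ?D z) \<le> t * (dens (t * z) * ?D a)"
      using t_gt_1 by simp
    also have "\<dots> \<longleftrightarrow> rho a * dens a * ?D z \<le> rho z * dens z * ?D a"
      by (simp add: mult.assoc[symmetric] dens_scaled)
    also have "rho z = rho a * exp ((t - 1) * (a - z))"
      using exp_mult_rho[of a z 0] by (simp add: mult.commute)
    also have "rho a * dens a * ?D z \<le> rho a * exp ((t - 1) * (a - z)) * dens z * ?D a \<longleftrightarrow> ?L"
      using rho_pos[of a] by (simp add: mult.assoc)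
    finally show ?thesis by simp
  qed
  show ?thesis
  proof (cases "z \<le> a")
    case True
    show ?thesis
    proof (rule nondecreasing_off_finite[of "{0, z - y}", OF _ True cont deriv])
      fix x assume "z < x"
      then have "exp ((t - 1) * (x - z)) * dens z * ?D x \<le> dens x * ?D z"
        unfolding sign using z t_gt_1 by (intro tail_increment_ratio) auto
      then show "0 \<le> H' x"
        using t_gt_1 dens_pos[OF z] by (simp add: H'_def)
    qed auto
  next
    case False
    have "- H a \<le> - H z"
    proof (rule nondecreasing_off_finite[of "{0, z - y}" a z "\<lambda>a. - H a" "\<lambda>a. - H' a"])
      fix x assume "a < x" "x < z"
      then have "dens x * ?D z \<le> exp ((t - 1) * (x - z)) * dens z * ?D x"
        unfolding sign' using a t_gt_1 by (intro tail_increment_ratio) auto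
      then show "0 \<le> - H' x"
        using t_gt_1 dens_pos[OF z] by (simp add: H'_def mult_nonneg_nonpos divide_nonpos_pos)
    qed (use False in \<open>auto intro!: continuous_intros cont DERIV_minus deriv\<close>)
    then show ?thesis by simp
  qed
qed

lemma tail_tangent:
  assumes y: "0 \<le> y" and z: "0 < z" and a: "0 \<le> a" and u: "u = 0 \<or> u = 1"
  shows "tail (t * y) - tail (t * z) + rho y * (u - tail y) + slope y z * (tail a - tail z)
    \<le> exp ((t - 1) * (a - z)) * (u - tail (t * a))"
proof -
  \<comment> \<open>Since \<open>e * rho k = rho y\<close>, the tangent to \<open>R\<close> at
    \<open>tail k\<close>, multiplied by \<open>e\<close>, has the required coefficient of
    \<open>u\<close>.\<close>
  define k e where "k = a + (y - z)" and "e = exp ((t - 1) * (a - z))"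
  have "tail (t * k) + rho k * (u - tail k) \<le> u"
    using u tail_scaled_le[of k] tail_scaled_ge[of k] by auto
  then have "e * (tail (t * k) + rho k * (u - tail k)) \<le> e * u"
    by (simp add: e_def)
  moreover have "e * rho k = rho y"
    using exp_mult_rho[of a z "y - z"] by (simp add: e_def k_def)
  then have "e * (tail (t * k) + rho k * (u - tail k)) = e * tail (t * k) + rho y * (u - tail k)"
    by (simp add: distrib_left flip: mult.assoc)
  ultimately show ?thesis
    using tail_shift_minimum[OF y z a] by (simp add: e_def k_def algebra_simps)
qed

text \<open>Covers empty level sets, whose measure 0 is not a value of \<open>tail\<close>: with
  \<open>u = 0\<close> the right-hand side of the tangent inequality is nonpositive for every
  \<open>a\<close>, and \<open>tail a\<close> tends to 0.\<close>

lemma tail_tangent_infinity: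
  assumes y: "0 \<le> y" and z: "0 < z"
  shows "tail (t * y) - tail (t * z) + rho y * (0 - tail y) + slope y z * (0 - tail z) \<le> 0"
proof (rule tendsto_upperbound)
  show "((\<lambda>a. tail (t * y) - tail (t * z) + rho y * (0 - tail y) + slope y z * (tail a - tail z))
     \<longlongrightarrow> tail (t * y) - tail (t * z) + rho y * (0 - tail y) + slope y z * (0 - tail z)) at_top"
    by (intro tendsto_intros tail_tendsto_0)
  show "\<forall>\<^sub>F a in at_top. tail (t * y) - tail (t * z) + rho y * (0 - tail y)
      + slope y z * (tail a - tail z) \<le> 0"
  proof (rule eventually_at_top_linorderI[of 0])
    fix a :: real assume "0 \<le> a"
    have "exp ((t - 1) * (a - z)) * (0 - tail (t * a)) \<le> 0"
      by (simp add: tail_nonneg)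
    with tail_tangent[OF y z \<open>0 \<le> a\<close>, of 0]
    show "tail (t * y) - tail (t * z) + rho y * (0 - tail y)
      + slope y z * (tail a - tail z) \<le> 0" by linarith
  qed
qed simp

end

section \<open>Dilations and radial averages\<close>

locale gamma_radial = gamma_shape s + prob_space \<mu> for s :: real and \<mu> :: "real measure" +
  fixes r :: real
  assumes sets_eq: "sets \<mu> = sets borel"
    and r_pos: "0 < r"
    and measure_abs_gt: "0 \<le> a \<Longrightarrow> measure \<mu> {x. a < \<bar>x\<bar>} = tail (a powr r)"
begin

lemma space_eq [simp]: "space \<mu> = UNIV"
  using sets_eq_imp_space_eq[OF sets_eq] by simp

lemma prob_UNIV [simp]: "prob UNIV = 1"
  using prob_space by simp

lemma sets_eq_borel [measurable_cong, simp]: "sets \<mu> = sets borel"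
  by (rule sets_eq)

lemma measurable_tail [measurable]: "tail \<in> borel_measurable borel"
  using continuous_tail by (rule borel_measurable_continuous_onI)

text \<open>Continuity of \<open>tail\<close> leaves no mass on \<open>\<bar>x\<bar> = a\<close>:
  the set lies in \<open>{x. b < \<bar>x\<bar>}\<close> for every \<open>b < a\<close>, and
  \<open>b\<close> increases to \<open>a\<close>.\<close>

lemma measure_abs_ge:
  assumes "0 \<le> a"
  shows "measure \<mu> {x. a \<le> \<bar>x\<bar>} = tail (a powr r)"
proof (cases "a = 0")
  case True
  then show ?thesis using prob_space by simp
next
  case False
  have "measure \<mu> {x. a \<le> \<bar>x\<bar>} \<le> tail (a powr r)"
  proof (rule tendsto_lowerbound)
    show "((\<lambda>b. tail (b powr r)) \<longlongrightarrow> tail (a powr r)) (at_left a)"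
    proof (rule continuous_on_tendsto_compose[OF continuous_tail[of UNIV]])
      show "((\<lambda>b. b powr r) \<longlongrightarrow> a powr r) (at_left a)"
        using False by (intro tendsto_intros) auto
    qed auto
    have "0 < a" using False assms by simp
    then show "\<forall>\<^sub>F b in at_left a. measure \<mu> {x. a \<le> \<bar>x\<bar>} \<le> tail (b powr r)"
      unfolding eventually_at_left_field
    proof (intro exI[of _ 0] conjI allI impI)
      fix b assume b: "0 < b" "b < a"
      have "measure \<mu> {x. a \<le> \<bar>x\<bar>} \<le> measure \<mu> {x. b < \<bar>x\<bar>}"
        using b by (intro finite_measure_mono) auto
      then show "measure \<mu> {x. a \<le> \<bar>x\<bar>} \<le> tail (b powr r)"
        using measure_abs_gt[of b] b by simp
    qed
  qed simp
  moreover have "measure \<mu> {x. a < \<bar>x\<bar>} \<le> measure \<mu> {x. a \<le> \<bar>x\<bar>}"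
    by (intro finite_measure_mono) auto
  ultimately show ?thesis using measure_abs_gt[OF assms] by simp
qed

text \<open>With \<open>b\<close> the infimum of the moduli in \<open>A\<close>, the set contains
  all points of modulus above \<open>b\<close> and none of modulus below. The boundary is null, so
  the single number \<open>b powr r\<close> serves every dilation.\<close>

lemma measure_coideal:
  assumes A: "A \<in> sets borel" "A \<noteq> {}" and up: "\<And>x y. x \<in> A \<Longrightarrow> \<bar>x\<bar> \<le> \<bar>y\<bar> \<Longrightarrow> y \<in> A"
  obtains a where "0 \<le> a"
    "\<And>\<tau>. 0 < \<tau> \<Longrightarrow> measure \<mu> {x. x / \<tau> \<in> A} = tail (\<tau> powr r * a)"
proof -
  define b where "b = Inf (abs ` A)"
  have bdd: "bdd_below (abs ` A)" by (rule bdd_belowI[of _ 0]) auto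
  have b0: "0 \<le> b" unfolding b_def using A by (intro cInf_greatest) auto
  have lo: "b \<le> \<bar>x\<bar>" if "x \<in> A" for x
    unfolding b_def using that bdd by (intro cInf_lower) auto
  have hi: "x \<in> A" if "b < \<bar>x\<bar>" for x
    using cInf_lessD[of "abs ` A" "\<bar>x\<bar>"] A(2) that up by (force simp: b_def)
  have "measure \<mu> {x. x / \<tau> \<in> A} = tail (\<tau> powr r * b powr r)" if \<tau>: "0 < \<tau>" for \<tau>
  proof -
    have M: "{x. x / \<tau> \<in> A} \<in> sets \<mu>" using A(1) by measurable
    have "measure \<mu> {x. \<tau> * b < \<bar>x\<bar>} \<le> measure \<mu> {x. x / \<tau> \<in> A}"
      using hi \<tau> M by (intro finite_measure_mono) (auto simp: field_simps)
    moreover have "measure \<mu> {x. x / \<tau> \<in> A} \<le> measure \<mu> {x. \<tau> * b \<le> \<bar>x\<bar>}"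
      using lo \<tau> by (intro finite_measure_mono) (force simp: field_simps)+
    ultimately show ?thesis
      using \<tau> b0 measure_abs_gt[of "\<tau> * b"] measure_abs_ge[of "\<tau> * b"] by (simp add: powr_mult)
  qed
  then show ?thesis using that[of "b powr r"] by simp
qed

text \<open>The quasi-arithmetic mean of \<open>tail (y (x / \<tau>))\<close> with respect to \<open>R\<close> is convex in \<open>tail \<circ> y\<close> and
  agrees with the ordinary mean on indicators of sets \<open>{x. a \<le> \<bar>x\<bar>}\<close>. A function monotone in \<open>\<bar>x\<bar>\<close> is a
  mixture, over its levels \<open>\<theta>\<close>, of such indicators.\<close>

lemma tail_integral_dilation:
  assumes \<tau>: "1 \<le> \<tau>" and meas [measurable]: "y \<in> borel_measurable borel"
    and y_nonneg: "\<And>x. 0 \<le> y x" and anti: "\<And>u v. \<bar>u\<bar> \<le> \<bar>v\<bar> \<Longrightarrow> y v \<le> y u"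
    and z: "0 \<le> z" and mean: "(\<integral>x. tail (y x) \<partial>\<mu>) = tail z"
  shows "(\<integral>x. tail (\<tau> powr r * y (x / \<tau>)) \<partial>\<mu>) \<le> tail (\<tau> powr r * z)"
proof -
  \<comment> \<open>The tangent plane inequality needs \<open>1 < t\<close> and
    \<open>0 < z\<close>. For \<open>z = 0\<close> the right-hand side is 1.\<close>
  consider "\<tau> = 1" | "z = 0" | "1 < \<tau>" "0 < z" using \<tau> z by fastforce
  then show ?thesis
  proof cases
    case 1
    then show ?thesis using mean by simp
  next
    case 2
    have "(\<integral>x. tail (\<tau> powr r * y (x / \<tau>)) \<partial>\<mu>) \<le> 1"
      by (rule integral_le_const) (auto intro!: integrable_const_bound[where B=1] simp: tail_nonneg tail_le_1)
    then show ?thesis using 2 by simp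
  next
    case 3
    define t where "t = \<tau> powr r"
    have "1 < t" using 3 r_pos by (simp add: t_def)
    interpret gamma_scaled s t by unfold_locales fact
    define Y where "Y x = y (x / \<tau>)" for x
    have [measurable]: "Y \<in> borel_measurable borel" unfolding Y_def by measurable
    have Y0: "0 \<le> Y x" for x by (simp add: Y_def y_nonneg)
    \<comment> \<open>Layer cake: \<open>tail (y x)\<close> is the average, over
      \<open>\<theta>\<close> uniform on (0, 1], of the indicators of its superlevel sets, and
      \<open>m \<theta>\<close> is their mass.\<close>
    define m :: "real \<Rightarrow> real" where "m \<theta> = (\<integral>x. (if \<theta> \<le> tail (y x) then 1 else 0) \<partial>\<mu>)" for \<theta>
    have m_eq: "m \<theta> = measure \<mu> {x. \<theta> \<le> tail (y x)}" for \<theta>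
    proof -
      have "m \<theta> = (\<integral>x. indicator {x. \<theta> \<le> tail (y x)} x \<partial>\<mu>)"
        unfolding m_def by (intro Bochner_Integration.integral_cong) (auto simp: indicator_def)
      then show ?thesis by simp
    qed
    have m_bound: "0 \<le> m \<theta>" "m \<theta> \<le> 1" for \<theta> by (auto simp: m_eq)
    have [measurable]: "m \<in> borel_measurable borel" unfolding m_def by measurable
    define U where "U = uniform_measure lborel {0<..1::real}"
    interpret U: prob_space U unfolding U_def by (rule prob_space_uniform_measure) auto
    have [measurable_cong, simp]: "sets U = sets borel" by (simp add: U_def)
    interpret P: pair_prob_space U \<mu> ..
    have layer: "(\<integral>\<theta>. (if \<theta> \<le> c then 1 else 0) \<partial>U) = c" if "0 \<le> c" "c \<le> 1" for c :: real
    proof -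
      have "(\<integral>\<theta>. (if \<theta> \<le> c then 1 else 0) \<partial>U) = (\<integral>\<theta>. indicator {..c} \<theta> \<partial>U)"
        by (intro Bochner_Integration.integral_cong) auto
      also have "\<dots> = measure U {..c}" by simp
      also have "{0<..1} \<inter> {..c} = {0<..c}" using that by auto
      then have "measure U {..c} = c" using that by (simp add: U_def measure_uniform_measure)
      finally show ?thesis .
    qed
    have mean_m: "(\<integral>\<theta>. m \<theta> \<partial>U) = tail z"
    proof -
      have "(\<integral>\<theta>. m \<theta> \<partial>U) = (\<integral>x. \<integral>\<theta>. (if \<theta> \<le> tail (y x) then 1 else 0) \<partial>U \<partial>\<mu>)"
        unfolding m_def
        by (rule P.Fubini_integral[symmetric], rule P.integrable_const_bound[where B=1])
          (auto simp: split_beta)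
      also have "\<dots> = (\<integral>x. tail (y x) \<partial>\<mu>)"
        by (simp add: layer tail_nonneg tail_le_1)
      finally show ?thesis using mean by simp
    qed
    \<comment> \<open>The left-hand side of the tangent plane inequality with base point
      \<open>(tail (Y x), tail z)\<close>, where \<open>u\<close> is the indicator of the dilated
      level set and \<open>tail a\<close> is replaced by \<open>m \<theta>\<close>. Averaging over
      \<open>\<theta>\<close> kills the linear terms, averaging over \<open>x\<close> gives a
      nonpositive number, and Fubini compares the two.\<close>
    define F where "F \<theta> x = tail (t * Y x) - tail (t * z)
      + rho (Y x) * ((if \<theta> \<le> tail (Y x) then 1 else 0) - tail (Y x))
      + slope (Y x) z * (m \<theta> - tail z)" for \<theta> x
    have rho_meas [measurable]: "rho \<in> borel_measurable borel" unfolding rho_def by measurable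
    have slope_meas [measurable]: "(\<lambda>x. slope (Y x) z) \<in> borel_measurable borel"
      unfolding slope_def by measurable
    have rho_bound: "\<bar>rho (Y x)\<bar> \<le> rho 0" for x
      using rho_antimono[OF Y0, of x] rho_pos[of "Y x"] by simp
    define S where "S = (t - 1) / dens z + rho z"
    have slope_bound: "\<bar>slope (Y x) z\<bar> \<le> S" for x
    proof -
      have "\<bar>tail (t * z) - tail (t * Y x)\<bar> \<le> 1"
        using tail_nonneg[of "t * z"] tail_nonneg[of "t * Y x"] tail_le_1[of "t * z"]
          tail_le_1[of "t * Y x"] by linarith
      then have "\<bar>(t - 1) * (tail (t * z) - tail (t * Y x)) / dens z\<bar> \<le> (t - 1) * 1 / dens z"
        unfolding abs_mult abs_divide using \<open>1 < t\<close> dens_pos[OF 3(2)]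
        by (intro frac_le mult_mono) auto
      then show ?thesis
        using rho_pos[of z] unfolding slope_def S_def by linarith
    qed
    have tail_bound: "\<bar>tail a\<bar> \<le> 1" for a using tail_nonneg tail_le_1 by simp
    have F_bound: "\<bar>F \<theta> x\<bar> \<le> 2 + rho 0 * 2 + S * 2" for \<theta> x
    proof -
      have "\<bar>tail (t * Y x) - tail (t * z)\<bar> \<le> 2"
        using tail_bound[of "t * Y x"] tail_bound[of "t * z"] by linarith
      moreover have "\<bar>rho (Y x) * ((if \<theta> \<le> tail (Y x) then 1 else 0) - tail (Y x))\<bar> \<le> rho 0 * 2"
        unfolding abs_mult
        by (intro mult_mono rho_bound) (use tail_bound[of "Y x"] rho_pos[of 0] tail_nonneg[of "Y x"] in auto)
      moreover have "\<bar>slope (Y x) z * (m \<theta> - tail z)\<bar> \<le> S * 2"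
        unfolding abs_mult
        using m_bound[of \<theta>] tail_bound[of z] slope_bound[of x] tail_nonneg[of z] by (intro mult_mono) auto
      ultimately show ?thesis unfolding F_def by linarith
    qed
    have F_meas [measurable]: "case_prod F \<in> borel_measurable (borel \<Otimes>\<^sub>M borel)"
      unfolding F_def by measurable
    have nonpos: "(\<integral>x. F \<theta> x \<partial>\<mu>) \<le> 0" if \<theta>: "0 < \<theta>" for \<theta>
    proof (cases "{x. \<theta> \<le> tail (y x)} = {}")
      case True
      have "F \<theta> x \<le> 0" for x
        using tail_tangent_infinity[OF Y0[of x] 3(2)] True m_eq[of \<theta>]
        by (auto simp: F_def Y_def indicator_def)
      then have "0 \<le> (\<integral>x. - F \<theta> x \<partial>\<mu>)" by (intro integral_nonneg_AE) simp
      then show ?thesis by simp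
    next
      case False
      have up: "v \<in> {x. \<theta> \<le> tail (y x)}" if "u \<in> {x. \<theta> \<le> tail (y x)}" "\<bar>u\<bar> \<le> \<bar>v\<bar>" for u v
        using that tail_antimono[OF anti[OF that(2)]] by simp
      have level: "{x. \<theta> \<le> tail (y x)} \<in> sets borel" by measurable
      obtain a where a: "0 \<le> a"
        "\<And>\<tau>. 0 < \<tau> \<Longrightarrow> measure \<mu> {x. x / \<tau> \<in> {x. \<theta> \<le> tail (y x)}} = tail (\<tau> powr r * a)"
      proof (rule measure_coideal[OF level False])
        show "v \<in> {x. \<theta> \<le> tail (y x)}" if "u \<in> {x. \<theta> \<le> tail (y x)}" "\<bar>u\<bar> \<le> \<bar>v\<bar>" for u v
          using that by (rule up)
      qed (rule that)
      have m_a: "m \<theta> = tail a" using a(2)[of 1] by (simp add: m_eq)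
      have "{x. \<theta> \<le> tail (Y x)} \<in> sets \<mu>" by measurable
      then have int: "integrable \<mu> (indicator {x. \<theta> \<le> tail (Y x)} :: real \<Rightarrow> real)"
        by (intro integrable_real_indicator) (simp_all add: emeasure_eq_measure)
      define E where "E = exp ((t - 1) * (a - z))"
      have "(\<integral>x. F \<theta> x \<partial>\<mu>) \<le> (\<integral>x. E * (indicator {x. \<theta> \<le> tail (Y x)} x - tail (t * a)) \<partial>\<mu>)"
      proof (rule integral_mono)
        show "integrable \<mu> (F \<theta>)"
          by (rule integrable_const_bound[where B="2 + rho 0 * 2 + S * 2"]) (auto simp: F_bound)
        show "F \<theta> x \<le> E * (indicator {x. \<theta> \<le> tail (Y x)} x - tail (t * a))" for x
          using tail_tangent[OF Y0[of x] 3(2) a(1), of "(if \<theta> \<le> tail (Y x) then 1 else 0)"]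
          by (auto simp: F_def E_def m_a indicator_def)
      qed (use int in simp)
      also have "\<dots> = E * (measure \<mu> {x. \<theta> \<le> tail (Y x)} - tail (t * a))"
        using int by simp
      \<comment> \<open>The same \<open>a\<close> gives the mass \<open>tail a\<close> of the level
        set and \<open>tail (t * a)\<close> of its dilate: this is the equality case of
        indicators.\<close>
      also have "\<dots> = 0"
        using a(2)[of \<tau>] 3 by (simp add: Y_def t_def)
      finally show ?thesis .
    qed
    have "(\<integral>x. tail (t * Y x) - tail (t * z) \<partial>\<mu>) = (\<integral>x. \<integral>\<theta>. F \<theta> x \<partial>U \<partial>\<mu>)"
    proof (intro Bochner_Integration.integral_cong refl)
      fix x
      have i1: "integrable U (\<lambda>\<theta>. (if \<theta> \<le> tail (Y x) then 1 else 0) :: real)"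
        by (rule U.integrable_const_bound[where B=1]) auto
      have i2: "integrable U m"
        by (rule U.integrable_const_bound[where B=1]) (auto simp: m_bound)
      have "(\<integral>\<theta>. F \<theta> x \<partial>U) = tail (t * Y x) - tail (t * z)
          + rho (Y x) * ((\<integral>\<theta>. (if \<theta> \<le> tail (Y x) then 1 else 0) \<partial>U) - tail (Y x))
          + slope (Y x) z * ((\<integral>\<theta>. m \<theta> \<partial>U) - tail z)"
        unfolding F_def
        using i1 i2 by (simp add: U.prob_space)
      then show "tail (t * Y x) - tail (t * z) = (\<integral>\<theta>. F \<theta> x \<partial>U)"
        by (simp add: layer tail_nonneg tail_le_1 mean_m)
    qed
    also have "\<dots> = (\<integral>\<theta>. \<integral>x. F \<theta> x \<partial>\<mu> \<partial>U)"
      by (rule P.Fubini_integral, rule P.integrable_const_bound[where B="2 + rho 0 * 2 + S * 2"])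
        (auto simp: F_bound split_beta)
    also have "\<dots> \<le> 0"
    proof -
      have "AE \<theta> in U. 0 < \<theta>"
        unfolding U_def by (rule AE_uniform_measureI) auto
      then have "AE \<theta> in U. 0 \<le> - (\<integral>x. F \<theta> x \<partial>\<mu>)"
        by eventually_elim (use nonpos in auto)
      then have "0 \<le> (\<integral>\<theta>. - (\<integral>x. F \<theta> x \<partial>\<mu>) \<partial>U)" by (rule integral_nonneg_AE)
      then show ?thesis by simp
    qed
    finally have "(\<integral>x. tail (t * Y x) \<partial>\<mu>) - tail (t * z) \<le> 0"
      by (subst (asm) Bochner_Integration.integral_diff)
        (auto intro!: integrable_const_bound[where B=1] simp: tail_bound)
    then show ?thesis by (simp add: t_def Y_def)
  qed
qed

end

section \<open>Product measures and ideals\<close>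

lemma sets_power_measure [simp, measurable_cong]: "sets (power_measure \<mu>) = sets borel"
  by (simp add: power_measure_def)

lemma space_power_measure [simp]: "space (power_measure \<mu>) = UNIV"
  by (simp add: power_measure_def)

lemma measurable_vec_of_fun:
  fixes \<mu> :: "real measure"
  assumes "sets \<mu> = sets borel"
  shows "(\<lambda>f. \<chi> i. f i) \<in> (\<Pi>\<^sub>M i\<in>(UNIV :: 'n::finite set). \<mu>) \<rightarrow>\<^sub>M borel"
proof (rule borel_measurable_euclidean_space[THEN iffD2], rule ballI)
  fix b :: "real ^ 'n" assume "b \<in> Basis"
  then obtain i where b: "b = axis i 1" by (auto simp: Basis_vec_def)
  have "(\<lambda>f. f i) \<in> (\<Pi>\<^sub>M i\<in>(UNIV :: 'n set). \<mu>) \<rightarrow>\<^sub>M \<mu>"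
    by (rule measurable_component_singleton) simp
  then show "(\<lambda>f. (\<chi> i. f i) \<bullet> b) \<in> borel_measurable (\<Pi>\<^sub>M i\<in>(UNIV :: 'n set). \<mu>)"
    by (simp add: b inner_axis measurable_cong_sets[OF refl assms])
qed

lemma prob_space_power_measure:
  assumes "prob_space \<mu>" "sets \<mu> = sets borel"
  shows "prob_space (power_measure \<mu> :: (real ^ 'n::finite) measure)"
proof -
  interpret prob_space "\<Pi>\<^sub>M i\<in>(UNIV :: 'n set). \<mu>"
    by (rule prob_space_PiM) (rule assms(1))
  show ?thesis
    unfolding power_measure_def by (rule prob_space_distr) (rule measurable_vec_of_fun[OF assms(2)])
qed

lemma is_ideal_iff:
  "is_ideal K \<longleftrightarrow> (\<forall>x\<in>K. \<forall>y. (\<forall>i. \<bar>y $ i\<bar> \<le> \<bar>x $ i\<bar>) \<longrightarrow> y \<in> K)"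
  for K :: "(real ^ 'n::finite) set"
  unfolding is_ideal_def by (auto simp: subset_iff mem_box_cart abs_le_iff minus_le_iff)

lemma dilate_eq_vimage: "0 < t \<Longrightarrow> dilate t K = {x. (1 / t) *\<^sub>R x \<in> K}"
  for K :: "(real ^ 'n) set"
  unfolding dilate_def by (auto intro!: image_eqI[where x="(1 / t) *\<^sub>R x" for x])

lemma dilate_borel:
  fixes K :: "(real ^ 'n::finite) set"
  assumes "K \<in> sets borel" "0 < t"
  shows "dilate t K \<in> sets borel"
proof -
  have "(\<lambda>x. (1 / t) *\<^sub>R x) -` K \<inter> space borel \<in> sets (borel :: (real ^ 'n) measure)"
    by (rule measurable_sets[OF _ assms(1)]) simp
  then show ?thesis using assms(2) by (simp add: dilate_eq_vimage vimage_def)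
qed

lemma dilate_strip: "0 < t \<Longrightarrow> dilate t (strip j w) = strip j (t * w)"
  by (auto simp: dilate_eq_vimage strip_def field_simps abs_mult)

lemma is_ideal_dilate:
  fixes K :: "(real ^ 'n::finite) set"
  assumes "is_ideal K" "0 < t"
  shows "is_ideal (dilate t K)"
  unfolding is_ideal_iff dilate_eq_vimage[OF assms(2)]
proof (intro ballI allI impI)
  fix x y assume x: "x \<in> {x. (1 / t) *\<^sub>R x \<in> K}" and le: "\<forall>i. \<bar>y $ i\<bar> \<le> \<bar>x $ i\<bar>"
  have "\<forall>i. \<bar>((1 / t) *\<^sub>R y) $ i\<bar> \<le> \<bar>((1 / t) *\<^sub>R x) $ i\<bar>"
    using le assms(2) by (auto simp: abs_mult intro!: divide_right_mono)
  then show "y \<in> {x. (1 / t) *\<^sub>R x \<in> K}"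
    using x assms(1) unfolding is_ideal_iff by blast
qed

lemma distr_power_measure_component:
  fixes j :: "'n::finite" and \<mu> :: "real measure"
  assumes "prob_space \<mu>" "sets \<mu> = sets borel"
  shows "distr (power_measure \<mu>) \<mu> (\<lambda>x. x $ j) = \<mu>"
proof -
  interpret product_prob_space "\<lambda>_. \<mu>" "UNIV :: 'n set"
    by (intro product_prob_spaceI assms)
  have "(\<lambda>x. x $ j) \<in> (borel :: (real ^ 'n) measure) \<rightarrow>\<^sub>M \<mu>"
    by (subst measurable_cong_sets[OF refl assms(2)]) simp
  from distr_distr[OF this measurable_vec_of_fun[OF assms(2)]]
  have "distr (power_measure \<mu>) \<mu> (\<lambda>x. x $ j) =
      distr (\<Pi>\<^sub>M i\<in>(UNIV :: 'n set). \<mu>) \<mu> (\<lambda>f. f j)"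
    by (simp add: power_measure_def comp_def)
  also have "\<dots> = \<mu>" by (rule PiM_component) simp
  finally show ?thesis .
qed

lemma measure_power_measure_component:
  fixes j :: "'n::finite" and \<mu> :: "real measure"
  assumes "prob_space \<mu>" "sets \<mu> = sets borel" "A \<in> sets borel"
  shows "measure (power_measure \<mu>) {x. x $ j \<in> A} = measure \<mu> A"
proof -
  have "measure \<mu> A = measure (distr (power_measure \<mu>) \<mu> (\<lambda>x. x $ j)) A"
    by (simp only: distr_power_measure_component[OF assms(1,2)])
  also have "\<dots> = measure (power_measure \<mu>) {x. x $ j \<in> A}"
  proof (subst measure_distr)
    show "(\<lambda>x :: real ^ 'n. x $ j) \<in> power_measure \<mu> \<rightarrow>\<^sub>M \<mu>"
      by (subst measurable_cong_sets[OF sets_power_measure assms(2)]) simp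
    show "measure (power_measure \<mu>) ((\<lambda>x. x $ j) -` A \<inter> space (power_measure \<mu>))
        = measure (power_measure \<mu>) {x. x $ j \<in> A}"
      by (simp add: vimage_def)
  qed (use assms in simp)
  finally show ?thesis by simp
qed

section \<open>The S-inequality for ideals, by induction on the coordinates\<close>

context gamma_radial
begin

text \<open>Index sets replace the vector type, whose dimension is fixed, so that coordinates can be
  added one at a time. Hypothesis and conclusion are upper bounds by tails, because the complement
  of \<open>K\<close> may be null while \<open>tail\<close> is positive.\<close>

lemma one_minus_measure_le_tail:
  fixes I :: "'i set"
  assumes "finite I" and \<tau>: "1 \<le> \<tau>"
    and "K \<in> sets (\<Pi>\<^sub>M i\<in>I. \<mu>)"
    and "\<And>x y. x \<in> K \<Longrightarrow> y \<in> space (\<Pi>\<^sub>M i\<in>I. \<mu>) \<Longrightarrow> (\<And>i. i \<in> I \<Longrightarrow> \<bar>y i\<bar> \<le> \<bar>x i\<bar>) \<Longrightarrow> y \<in> K"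
    and "0 \<le> z" and "1 - measure (\<Pi>\<^sub>M i\<in>I. \<mu>) K \<le> tail z"
  shows "1 - measure (\<Pi>\<^sub>M i\<in>I. \<mu>) {x \<in> space (\<Pi>\<^sub>M i\<in>I. \<mu>). (\<lambda>i\<in>I. x i / \<tau>) \<in> K}
    \<le> tail (\<tau> powr r * z)"
  using assms(1,3-)
proof (induction I arbitrary: K z)
  case empty
  interpret E: prob_space "\<Pi>\<^sub>M i\<in>{}. \<mu>" by (rule prob_space_PiM) (rule prob_space_axioms)
  have sp: "space (\<Pi>\<^sub>M i\<in>({}::'i set). \<mu>) = {\<lambda>_. undefined}" by (simp add: space_PiM)
  then have "K \<subseteq> {\<lambda>_. undefined}" using empty(1) sets.sets_into_space by blast
  \<comment> \<open>The space is a single point. If \<open>K\<close> is empty, its complement has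
    mass 1, which forces \<open>z = 0\<close>.\<close>
  then consider "K = {}" | "K = space (\<Pi>\<^sub>M i\<in>({}::'i set). \<mu>)" unfolding sp by blast
  then show ?case
  proof cases
    case 1
    then have "tail 0 \<le> tail z" using empty by simp
    then have "z = 0" using tail_le_iff[of 0 z] empty by simp
    then show ?thesis by simp
  next
    case 2
    then have "{x \<in> space (\<Pi>\<^sub>M i\<in>({}::'i set). \<mu>). (\<lambda>i\<in>{}. x i / \<tau>) \<in> K} = space (\<Pi>\<^sub>M i\<in>{}. \<mu>)"
      unfolding sp by auto
    then show ?thesis by (simp only: E.prob_space diff_self tail_nonneg)
  qed
next
  case (insert i I)
  let ?P = "\<Pi>\<^sub>M i\<in>I. \<mu>" and ?Q = "\<Pi>\<^sub>M i\<in>insert i I. \<mu>"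
  interpret prod: product_prob_space "\<lambda>_ :: 'i. \<mu>" UNIV
    by (intro product_prob_spaceI) (rule prob_space_axioms)
  interpret PI: prob_space ?P by (rule prob_space_PiM) (rule prob_space_axioms)
  interpret QI: prob_space ?Q by (rule prob_space_PiM) (rule prob_space_axioms)
  define slice where "slice A c = {x \<in> space ?P. x(i := c) \<in> A}" for A c
  have upd [measurable]: "(\<lambda>(c, x). x(i := c)) \<in> \<mu> \<Otimes>\<^sub>M ?P \<rightarrow>\<^sub>M ?Q"
    by measurable
  have upd_c [measurable]: "(\<lambda>x. x(i := c)) \<in> ?P \<rightarrow>\<^sub>M ?Q" for c
    using measurable_compose[OF measurable_Pair1' upd, of c] by simp
  have upd_space: "x(i := c) \<in> space ?Q" if "x \<in> space ?P" for x c
    using measurable_space[OF upd_c that] .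
  have slice_sets: "slice A c \<in> sets ?P" if "A \<in> sets ?Q" for A c
    using measurable_sets[OF upd_c that] by (simp add: slice_def vimage_def Int_def conj_commute)
  have slice_meas: "(\<lambda>c. measure ?P (slice A c)) \<in> borel_measurable borel" if "A \<in> sets ?Q" for A
  proof -
    have "(\<lambda>c. emeasure ?P (Pair c -` ((\<lambda>(c, x). x(i := c)) -` A \<inter> space (\<mu> \<Otimes>\<^sub>M ?P))))
        \<in> borel_measurable \<mu>"
      by (rule PI.measurable_emeasure_Pair) (rule measurable_sets[OF upd that])
    also have "(\<lambda>c. Pair c -` ((\<lambda>(c, x). x(i := c)) -` A \<inter> space (\<mu> \<Otimes>\<^sub>M ?P))) = slice A"
      by (auto simp: slice_def space_pair_measure)
    finally show ?thesis unfolding measure_def by measurable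
  qed
  have fubini: "measure ?Q A = (\<integral>c. measure ?P (slice A c) \<partial>\<mu>)" if A: "A \<in> sets ?Q" for A
  proof -
    have "emeasure ?Q A = (\<integral>\<^sup>+c. \<integral>\<^sup>+x. indicator A (x(i := c)) \<partial>?P \<partial>\<mu>)"
      using prod.product_nn_integral_insert_rev[OF insert(1,2), of "indicator A"] A by simp
    also have "\<dots> = (\<integral>\<^sup>+c. emeasure ?P (slice A c) \<partial>\<mu>)"
    proof (rule nn_integral_cong)
      fix c
      have "(\<integral>\<^sup>+x. indicator A (x(i := c)) \<partial>?P) = (\<integral>\<^sup>+x. indicator (slice A c) x \<partial>?P)"
        by (rule nn_integral_cong) (auto simp: slice_def indicator_def)
      then show "(\<integral>\<^sup>+x. indicator A (x(i := c)) \<partial>?P) = emeasure ?P (slice A c)"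
        using slice_sets[OF A] by simp
    qed
    finally have "emeasure ?Q A = (\<integral>\<^sup>+c. ennreal (measure ?P (slice A c)) \<partial>\<mu>)"
      by (simp add: PI.emeasure_eq_measure)
    then show ?thesis
      using slice_meas[OF A] by (simp add: integral_eq_nn_integral measure_def)
  qed
  define dil where "dil J K = {x \<in> space (\<Pi>\<^sub>M i\<in>J. \<mu>). (\<lambda>i\<in>J. x i / \<tau>) \<in> K}" for J :: "'i set" and K
  have dil_sets: "dil J A \<in> sets (\<Pi>\<^sub>M i\<in>J. \<mu>)" if "A \<in> sets (\<Pi>\<^sub>M i\<in>J. \<mu>)" for J A
  proof -
    have "(\<lambda>x. \<lambda>i\<in>J. x i / \<tau>) \<in> (\<Pi>\<^sub>M i\<in>J. \<mu>) \<rightarrow>\<^sub>M (\<Pi>\<^sub>M i\<in>J. \<mu>)"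
      by measurable
    from measurable_sets[OF this that] show ?thesis
      by (simp add: dil_def vimage_def Int_def conj_commute)
  qed
  \<comment> \<open>A slice of the dilate is the dilate of the slice at the contracted height
    \<open>c / \<tau>\<close>, to which the induction hypothesis applies.\<close>
  have slice_dil: "slice (dil (insert i I) K) c = dil I (slice K (c / \<tau>))" for c
  proof -
    have "(\<lambda>j\<in>insert i I. (x(i := c)) j / \<tau>) = (\<lambda>j\<in>I. x j / \<tau>)(i := c / \<tau>)" for x
      using insert(2) by (auto simp: fun_eq_iff)
    then show ?thesis
      by (auto simp: slice_def dil_def space_PiM PiE_def extensional_def)
  qed
  \<comment> \<open>The mass outside the slice at height \<open>c\<close>. It grows with
    \<open>\<bar>c\<bar>\<close> because \<open>K\<close> is an ideal, as the one-dimensional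
    averaging requires.\<close>
  define h where "h c = 1 - measure ?P (slice K c)" for c
  have h_bounds: "0 \<le> h c" "h c \<le> 1" for c by (auto simp: h_def)
  have h_meas [measurable]: "h \<in> borel_measurable borel"
    unfolding h_def using slice_meas[OF insert(4)] by measurable
  have h_mono: "h u \<le> h v" if "\<bar>u\<bar> \<le> \<bar>v\<bar>" for u v
  proof -
    have "slice K v \<subseteq> slice K u"
    proof
      fix x assume x: "x \<in> slice K v"
      have "x(i := u) \<in> K"
      proof (rule insert(5))
        show "x(i := v) \<in> K" using x by (simp add: slice_def)
        show "x(i := u) \<in> space ?Q" using x by (intro upd_space) (simp add: slice_def)
      qed (use that in auto)
      then show "x \<in> slice K u" using x by (simp add: slice_def)
    qed
    then show ?thesis
      unfolding h_def using PI.finite_measure_mono[OF _ slice_sets[OF insert(4)]] by simp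
  qed
  have int_h: "integrable \<mu> h"
    by (rule integrable_const_bound[where B=1]) (auto simp: h_bounds)
  have int_m: "integrable \<mu> (\<lambda>c. measure ?P (slice A c))" if "A \<in> sets ?Q" for A
    using slice_meas[OF that] by (intro integrable_const_bound[where B=1]) auto
  have mean_h: "1 - measure ?Q K = (\<integral>c. h c \<partial>\<mu>)"
    unfolding h_def using int_m[OF insert(4)] by (simp add: fubini[OF insert(4)])
  have mean_dil: "1 - measure ?Q (dil (insert i I) K) = (\<integral>c. 1 - measure ?P (dil I (slice K (c / \<tau>))) \<partial>\<mu>)"
    using int_m[OF dil_sets[OF insert(4)]]
    by (simp add: fubini[OF dil_sets[OF insert(4)]] slice_dil)
  have main: "1 - measure ?Q (dil (insert i I) K) \<le> tail (\<tau> powr r * z')" if z': "0 \<le> z'" "z' < z" for z'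
  proof -
    \<comment> \<open>The complement of a slice may be null, and then its measure is not of the form \<open>tail (y c)\<close>;
      the perturbation by \<open>e\<close> keeps it positive.\<close>
    define e where "e = tail z' - tail z"
    have e: "0 < e" "e < 1"
      using z' tail_strict_antimono[of z' z] tail_le_1[of z'] tail_pos[of z] by (auto simp: e_def)
    have "\<exists>y\<ge>0. tail y = (1 - e) * h c + e" for c
    proof -
      have "0 < (1 - e) * h c + e" using e h_bounds[of c] by (simp add: add_nonneg_pos)
      moreover have "(1 - e) * h c \<le> (1 - e) * 1"
        using e h_bounds[of c] by (intro mult_left_mono) auto
      then have "(1 - e) * h c + e \<le> 1" by simp
      ultimately show ?thesis using tail_surj by metis
    qed
    then obtain y where y: "\<And>c. 0 \<le> y c" "\<And>c. tail (y c) = (1 - e) * h c + e" by metis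
    have y_anti: "y v \<le> y u" if "\<bar>u\<bar> \<le> \<bar>v\<bar>" for u v
    proof -
      have "tail (y u) \<le> tail (y v)"
        unfolding y(2) using h_mono[OF that] e by (intro add_right_mono mult_left_mono) auto
      then show ?thesis using tail_le_iff y(1) by simp
    qed
    \<comment> \<open>Since \<open>y\<close> is obtained by choice, its measurability is read off
      from \<open>h\<close> by comparing tails; negative levels are separate because
      \<open>tail\<close> is constant there.\<close>
    have y_meas [measurable]: "y \<in> borel_measurable borel"
      unfolding borel_measurable_iff_ge
    proof
      fix a :: real
      show "{w \<in> space borel. a \<le> y w} \<in> sets borel"
      proof (cases "a < 0")
        case True
        then have "a \<le> y w" for w using y(1)[of w] by linarith
        then show ?thesis by simp
      next
        case False
        then have "a \<le> y w \<longleftrightarrow> (1 - e) * h w + e \<le> tail a" for w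
          using tail_le_iff[OF y(1)[of w], of a] y(2)[of w] by simp
        then show ?thesis by simp
      qed
    qed
    have "0 < (1 - e) * (\<integral>c. h c \<partial>\<mu>) + e"
      using e h_bounds by (intro add_nonneg_pos mult_nonneg_nonneg integral_nonneg_AE) auto
    \<comment> \<open>The perturbation adds at most \<open>e\<close> to the mean, and
      \<open>tail z + e = tail z'\<close>.\<close>
    moreover have le: "(1 - e) * (\<integral>c. h c \<partial>\<mu>) + e \<le> tail z'"
    proof -
      have "(1 - e) * (\<integral>c. h c \<partial>\<mu>) \<le> 1 * (\<integral>c. h c \<partial>\<mu>)"
        using e h_bounds by (intro mult_right_mono integral_nonneg_AE) auto
      then show ?thesis using insert(7) mean_h by (simp add: e_def)
    qed
    ultimately obtain w where w: "0 \<le> w" "tail w = (1 - e) * (\<integral>c. h c \<partial>\<mu>) + e"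
      using tail_surj[of "(1 - e) * (\<integral>c. h c \<partial>\<mu>) + e"] tail_le_1[of z'] by force
    have "1 - measure ?Q (dil (insert i I) K) \<le> (\<integral>c. tail (\<tau> powr r * y (c / \<tau>)) \<partial>\<mu>)"
      unfolding mean_dil
    proof (rule integral_mono)
      show "integrable \<mu> (\<lambda>c. 1 - measure ?P (dil I (slice K (c / \<tau>))))"
        using int_m[OF dil_sets[OF insert(4)]] by (simp add: slice_dil)
      show "integrable \<mu> (\<lambda>c. tail (\<tau> powr r * y (c / \<tau>)))"
        by (rule integrable_const_bound[where B=1]) (auto simp: tail_nonneg tail_le_1)
      fix c
      show "1 - measure ?P (dil I (slice K (c / \<tau>))) \<le> tail (\<tau> powr r * y (c / \<tau>))"
        unfolding dil_def
      proof (rule insert(3)[OF slice_sets[OF insert(4)] _ y(1)])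
        show "v \<in> slice K (c / \<tau>)"
          if "u \<in> slice K (c / \<tau>)" "v \<in> space ?P" "\<And>j. j \<in> I \<Longrightarrow> \<bar>v j\<bar> \<le> \<bar>u j\<bar>" for u v
        proof -
          have "v(i := c / \<tau>) \<in> K"
          proof (rule insert(5))
            show "u(i := c / \<tau>) \<in> K" using that by (simp add: slice_def)
            show "v(i := c / \<tau>) \<in> space ?Q" using that by (intro upd_space)
          qed (use that insert(2) in auto)
          then show ?thesis using that by (simp add: slice_def)
        qed
        \<comment> \<open>The perturbed value dominates \<open>h\<close>, so
          \<open>y (c / \<tau>)\<close> is an admissible bound in the induction hypothesis for the
          slice.\<close>
        have "e * h (c / \<tau>) \<le> e * 1"
          using e h_bounds[of "c / \<tau>"] by (intro mult_left_mono) auto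
        then have "h (c / \<tau>) \<le> (1 - e) * h (c / \<tau>) + e" by (simp add: algebra_simps)
        then show "1 - measure ?P (slice K (c / \<tau>)) \<le> tail (y (c / \<tau>))"
          by (simp add: y(2) h_def)
      qed
    qed
    also have "\<dots> \<le> tail (\<tau> powr r * w)"
      using int_h by (intro tail_integral_dilation \<tau> y_meas y(1) y_anti w(1)) (simp_all add: w(2) y(2))
    also have "\<dots> \<le> tail (\<tau> powr r * z')"
      using le w tail_le_iff[OF w(1) z'(1)] by (intro tail_antimono mult_left_mono) auto
    finally show ?thesis .
  qed
  have "1 - measure ?Q (dil (insert i I) K) \<le> tail (\<tau> powr r * z)"
  proof (cases "z = 0")
    case True
    then show ?thesis by simp
  next
    case False
    with insert(6) have "0 < z" by simp
    \<comment> \<open>The margin \<open>z' < z\<close> is removed by continuity of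
      \<open>tail\<close>.\<close>
    show ?thesis
    proof (rule tendsto_lowerbound)
      show "((\<lambda>b. tail (\<tau> powr r * b)) \<longlongrightarrow> tail (\<tau> powr r * z)) (at_left z)"
        by (rule continuous_on_tendsto_compose[OF continuous_tail[of UNIV]]) (auto intro!: tendsto_intros)
      show "\<forall>\<^sub>F b in at_left z. 1 - measure ?Q (dil (insert i I) K) \<le> tail (\<tau> powr r * b)"
        unfolding eventually_at_left_field using \<open>0 < z\<close> main by (intro exI[of _ 0]) auto
    qed simp
  qed
  then show ?case unfolding dil_def .
qed

text \<open>The complement of the strip of half-width \<open>w\<close> has mass
  \<open>tail (w powr r)\<close>, and dilation multiplies \<open>w powr r\<close> by
  \<open>t powr r\<close>. So strips attain equality in the bound for ideals with
  \<open>z = w powr r\<close>.\<close>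

theorem supports_S_inequality_ideals_power_measure:
  "supports_S_inequality_ideals (j :: 'n::finite) (power_measure \<mu>)"
  unfolding supports_S_inequality_ideals_def supports_S_inequality_def
proof (intro ballI impI allI)
  fix L :: "(real ^ 'n) set" and \<sigma> w t :: real
  let ?M = "power_measure \<mu> :: (real ^ 'n) measure" and ?P = "\<Pi>\<^sub>M i\<in>(UNIV :: 'n set). \<mu>"
  assume L: "L \<in> sets borel" "is_ideal L" and \<sigma>: "0 < \<sigma>" and w: "0 \<le> w" and t: "1 \<le> t"
    and eq: "measure ?M (dilate \<sigma> L) = measure ?M (strip j w)"
  define K where "K = dilate \<sigma> L"
  define K' where "K' = {f. (\<chi> i. f i) \<in> K}"
  have K: "K \<in> sets borel" "is_ideal K"
    using L \<sigma> by (simp_all add: K_def dilate_borel is_ideal_dilate)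
  have sp: "space ?P = UNIV" by (simp add: space_PiM)
  have meas: "measure ?M A = measure ?P {f. (\<chi> i. f i) \<in> A}" if "A \<in> sets borel" for A
    unfolding power_measure_def using that
    by (subst measure_distr[OF measurable_vec_of_fun[OF sets_eq]]) (auto simp: vimage_def sp)
  have K': "K' \<in> sets ?P"
    using measurable_sets[OF measurable_vec_of_fun[OF sets_eq] K(1)]
    by (simp add: K'_def vimage_def sp)
  have strip: "measure ?M (strip j a) = 1 - tail (a powr r)" if "0 \<le> a" for a
  proof -
    have "measure ?M (strip j a) = measure \<mu> {x. \<bar>x\<bar> \<le> a}"
      using measure_power_measure_component[OF prob_space_axioms sets_eq, of "{x. \<bar>x\<bar> \<le> a}" j]
      by (simp add: strip_def)
    also have "\<dots> = 1 - measure \<mu> {x. a < \<bar>x\<bar>}"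
      using prob_compl[of "{x. a < \<bar>x\<bar>}"] by (simp add: Compl_eq_Diff_UNIV[symmetric] not_less Collect_neg_eq[symmetric])
    finally show ?thesis using measure_abs_gt[OF that] by simp
  qed
  have "1 - measure ?P {x \<in> space ?P. (\<lambda>i\<in>UNIV. x i / t) \<in> K'} \<le> tail (t powr r * w powr r)"
  proof (rule one_minus_measure_le_tail[OF _ t K'])
    fix x y assume "x \<in> K'" "\<And>i. i \<in> UNIV \<Longrightarrow> \<bar>y i\<bar> \<le> \<bar>x i\<bar>"
    then show "y \<in> K'"
      using K(2) unfolding K'_def is_ideal_iff by force
  next
    have "measure ?P K' = measure ?M K" using meas[OF K(1)] by (simp add: K'_def)
    then show "1 - measure ?P K' \<le> tail (w powr r)"
      using eq strip[OF w] by (simp add: K_def)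
  qed (use w in auto)
  moreover have "{x \<in> space ?P. (\<lambda>i\<in>UNIV. x i / t) \<in> K'} = {f. (\<chi> i. f i) \<in> dilate t K}"
    using t by (auto simp: sp K'_def dilate_eq_vimage scaleR_vec_def restrict_def)
  moreover have "t powr r * w powr r = (t * w) powr r"
    using t w by (simp add: powr_mult)
  ultimately show "measure ?M (dilate t (strip j w)) \<le> measure ?M (dilate t (dilate \<sigma> L))"
    using meas[OF dilate_borel[OF K(1), of t]] t strip[of "t * w"] w
    by (simp add: dilate_strip K_def)
qed

end

section \<open>The three families\<close>

text \<open>The symmetric density under which \<open>\<bar>x\<bar> powr r\<close> has the Gamma law
  of shape \<open>s\<close>; the factor 2 splits the mass between the half-lines.\<close>

definition radial_density :: "real \<Rightarrow> real \<Rightarrow> real \<Rightarrow> real" where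
  "radial_density s r x = r / (2 * Gamma s) * \<bar>x\<bar> powr (r * s - 1) * exp (- (\<bar>x\<bar> powr r))"

lemma measurable_radial_density [measurable]: "radial_density s r \<in> borel_measurable borel"
  unfolding radial_density_def by measurable

context gamma_shape
begin

lemma radial_density_nonneg: "0 < r \<Longrightarrow> 0 \<le> radial_density s r x"
  using Gamma_s_pos by (simp add: radial_density_def)

lemma radial_density_has_derivative:
  assumes r: "0 < r" and x: "0 < x"
  shows "((\<lambda>x. - tail (x powr r) / 2) has_real_derivative radial_density s r x) (at x)"
proof -
  have "((\<lambda>x. x powr r) has_real_derivative r * x powr (r - 1)) (at x)"
    using x by (auto intro!: derivative_eq_intros)
  from DERIV_chain2[OF tail_has_derivative this]
  have "((\<lambda>x. tail (x powr r)) has_real_derivative - dens (x powr r) * (r * x powr (r - 1))) (at x)"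
    using x by simp
  from DERIV_cmult[OF this, of "-1/2"]
  have "((\<lambda>x. - tail (x powr r) / 2) has_real_derivative dens (x powr r) * (r * x powr (r - 1)) / 2) (at x)"
    by simp
  also have "dens (x powr r) * (r * x powr (r - 1)) / 2 = radial_density s r x"
  proof -
    have "x powr (r * (s - 1)) * x powr (r - 1) = x powr (r * s - 1)"
      by (simp add: algebra_simps flip: powr_add)
    then show ?thesis
      using x by (simp add: dens_def radial_density_def powr_powr field_simps)
  qed
  finally show ?thesis .
qed

text \<open>On each half-line the antiderivative is half a tail. A positive \<open>a\<close> keeps
  away from the origin, where the density is unbounded if \<open>r * s < 1\<close>.\<close>

lemma emeasure_radial_abs_ge:
  assumes r: "0 < r" and a: "0 < a"
  shows "emeasure (density lborel (radial_density s r)) {x. a \<le> \<bar>x\<bar>} = ennreal (tail (a powr r))"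
proof -
  let ?f = "\<lambda>x. ennreal (radial_density s r x)"
  have "filterlim (\<lambda>x. exp (r * ln x)) at_top at_top"
    using r by (intro filterlim_compose[OF exp_at_top]
      filterlim_tendsto_pos_mult_at_top[OF tendsto_const _ ln_at_top])
  then have powr_at_top: "filterlim (\<lambda>x. x powr r) at_top at_top"
    by (rule filterlim_cong[THEN iffD1, OF refl refl, rotated])
      (auto simp: powr_def intro!: eventually_at_top_linorderI[of 1])
  have lim: "((\<lambda>x. - tail (x powr r) / 2) \<longlongrightarrow> - 0 / 2) at_top"
    by (intro tendsto_intros filterlim_compose[OF tail_tendsto_0] powr_at_top) auto
  have right: "(\<integral>\<^sup>+x. ?f x * indicator {a..} x \<partial>lborel) = ennreal (tail (a powr r) / 2)"
    using nn_integral_FTC_atLeast[OF measurable_radial_density radial_density_has_derivative[OF r]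
        radial_density_nonneg[OF r] lim, of a] a by simp
  have left: "(\<integral>\<^sup>+x. ?f x * indicator {..-a} x \<partial>lborel) = ennreal (tail (a powr r) / 2)"
  proof -
    have "(\<integral>\<^sup>+x. ?f x * indicator {..-a} x \<partial>lborel)
        = (\<integral>\<^sup>+x. ?f (- x) * indicator {..-a} (- x) \<partial>lborel)"
      using nn_integral_real_affine[of "\<lambda>x. ?f x * indicator {..-a} x" "-1" 0] by simp
    also have "\<dots> = (\<integral>\<^sup>+x. ?f x * indicator {a..} x \<partial>lborel)"
      by (intro nn_integral_cong) (auto simp: radial_density_def indicator_def)
    finally show ?thesis using right by simp
  qed
  have "emeasure (density lborel (radial_density s r)) {x. a \<le> \<bar>x\<bar>}
      = (\<integral>\<^sup>+x. ?f x * indicator {x. a \<le> \<bar>x\<bar>} x \<partial>lborel)"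
    by (rule emeasure_density) auto
  also have "\<dots> = (\<integral>\<^sup>+x. ?f x * indicator {a..} x + ?f x * indicator {..-a} x \<partial>lborel)"
    using a by (intro nn_integral_cong) (auto simp: indicator_def abs_if split: if_splits)
  also have "\<dots> = ennreal (tail (a powr r) / 2) + ennreal (tail (a powr r) / 2)"
    by (subst nn_integral_add) (auto simp: left right)
  also have "\<dots> = ennreal (tail (a powr r))"
    by (simp add: tail_nonneg flip: ennreal_plus)
  finally show ?thesis .
qed

text \<open>The punctured line is exhausted by sets bounded away from 0, whose masses tend to
  \<open>tail 0 = 1\<close>; the origin is a null set.\<close>

lemma emeasure_radial_total:
  assumes r: "0 < r"
  shows "emeasure (density lborel (radial_density s r)) (- {0}) = 1"
    and "emeasure (density lborel (radial_density s r)) UNIV = 1"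
proof -
  let ?M = "density lborel (radial_density s r)"
  define A where "A n = {x::real. 1 / real (Suc n) \<le> \<bar>x\<bar>}" for n
  have "(\<Union>n. A n) = - {0}"
  proof (intro set_eqI iffI)
    fix x :: real assume "x \<in> - {0}"
    then have "0 < \<bar>x\<bar>" by simp
    from reals_Archimedean[OF this] show "x \<in> (\<Union>n. A n)"
      by (auto simp: A_def inverse_eq_divide intro: less_imp_le)
  qed (auto simp: A_def)
  moreover have "(\<lambda>n. emeasure ?M (A n)) \<longlonglongrightarrow> emeasure ?M (\<Union>n. A n)"
  proof (rule Lim_emeasure_incseq)
    show "incseq A"
      unfolding incseq_def A_def
      by (intro allI impI Collect_mono) (rule order_trans[OF frac_le], auto)
  qed (auto simp: A_def)
  moreover have "(\<lambda>n. emeasure ?M (A n)) \<longlonglongrightarrow> 1"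
  proof -
    have "(\<lambda>n. tail ((1 / real (Suc n)) powr r)) \<longlonglongrightarrow> tail (0 powr r)"
    proof (rule continuous_on_tendsto_compose[OF continuous_tail[of UNIV]])
      show "(\<lambda>n. (1 / real (Suc n)) powr r) \<longlonglongrightarrow> 0 powr r"
        by (rule tendsto_powr'[OF LIMSEQ_Suc[OF lim_1_over_n] tendsto_const]) (use r in auto)
    qed auto
    then have "(\<lambda>n. ennreal (tail ((1 / real (Suc n)) powr r))) \<longlonglongrightarrow> ennreal 1"
      by (intro tendsto_ennrealI) simp
    moreover have "emeasure ?M (A n) = ennreal (tail ((1 / real (Suc n)) powr r))" for n
      unfolding A_def by (rule emeasure_radial_abs_ge[OF r]) simp
    ultimately show ?thesis by simp
  qed
  ultimately show 1: "emeasure ?M (- {0}) = 1"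
    using LIMSEQ_unique by metis
  have "AE x in lborel. x \<noteq> (0::real)" by (rule AE_lborel_singleton)
  then have "emeasure ?M UNIV = emeasure ?M (- {0})"
    by (intro emeasure_eq_AE) (auto simp: AE_density elim: eventually_mono)
  with 1 show "emeasure ?M UNIV = 1" by simp
qed

lemma gamma_radial_radial_density:
  assumes r: "0 < r"
  shows "gamma_radial s (density lborel (radial_density s r)) r"
proof -
  let ?M = "density lborel (radial_density s r)"
  interpret prob_space ?M
    by (rule prob_spaceI) (simp add: emeasure_radial_total[OF r])
  show ?thesis
  proof
    fix a :: real assume a: "0 \<le> a"
    have "emeasure ?M {x. a < \<bar>x\<bar>} = ennreal (tail (a powr r))"
    proof (cases "a = 0")
      case True
      then have "{x. a < \<bar>x\<bar>} = - {0}" by auto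
      then show ?thesis using emeasure_radial_total[OF r] True by simp
    next
      case False
      have "AE x in lborel. x \<noteq> a \<and> x \<noteq> - a"
        by (intro AE_conjI AE_lborel_singleton)
      then have "emeasure ?M {x. a < \<bar>x\<bar>} = emeasure ?M {x. a \<le> \<bar>x\<bar>}"
        by (intro emeasure_eq_AE) (auto simp: AE_density abs_if le_less elim: eventually_mono)
      then show ?thesis using emeasure_radial_abs_ge[OF r, of a] False a by simp
    qed
    then show "measure ?M {x. a < \<bar>x\<bar>} = tail (a powr r)"
      by (simp add: measure_def tail_nonneg)
  qed (use r in auto)
qed

lemma moment_radial_density_finite:
  assumes r: "0 < r" and q: "0 < q"
  shows "moment (density lborel (radial_density s r)) abs q < \<infinity>"
proof -
  \<comment> \<open>The factor \<open>\<bar>x\<bar> powr q\<close> only raises the shape: up to a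
    constant the integrand is the radial density of shape \<open>s + q / r\<close>, which has mass
    1.\<close>
  define s' where "s' = s + q / r"
  interpret T: gamma_shape s'
    by unfold_locales (use s_ge_1 q r in \<open>simp add: s'_def add_increasing2\<close>)
  have eq: "radial_density s r x * \<bar>x\<bar> powr q = Gamma s' / Gamma s * radial_density s' r x" for x
  proof -
    have "r * s' - 1 = (r * s - 1) + q" using r by (simp add: s'_def algebra_simps)
    then have "\<bar>x\<bar> powr (r * s' - 1) = \<bar>x\<bar> powr (r * s - 1) * \<bar>x\<bar> powr q"
      by (simp only: powr_add)
    then show ?thesis
      using Gamma_s_pos T.Gamma_s_pos by (simp add: radial_density_def field_simps)
  qed
  have "moment (density lborel (radial_density s r)) abs q
      = (\<integral>\<^sup>+x. ennreal (radial_density s r x) * ennreal (\<bar>x\<bar> powr q) \<partial>lborel)"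
    unfolding moment_def by (rule nn_integral_density) auto
  also have "\<dots> = (\<integral>\<^sup>+x. ennreal (Gamma s' / Gamma s) * ennreal (radial_density s' r x) \<partial>lborel)"
  proof (rule nn_integral_cong)
    fix x
    have "ennreal (radial_density s r x) * ennreal (\<bar>x\<bar> powr q)
        = ennreal (radial_density s r x * \<bar>x\<bar> powr q)"
      by (rule ennreal_mult[symmetric]) (simp_all add: radial_density_nonneg[OF r])
    also have "\<dots> = ennreal (Gamma s' / Gamma s) * ennreal (radial_density s' r x)"
      unfolding eq using Gamma_s_pos T.Gamma_s_pos
      by (intro ennreal_mult) (simp_all add: T.radial_density_nonneg[OF r])
    finally show "ennreal (radial_density s r x) * ennreal (\<bar>x\<bar> powr q)
        = ennreal (Gamma s' / Gamma s) * ennreal (radial_density s' r x)" .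
  qed
  also have "\<dots> = ennreal (Gamma s' / Gamma s) * (\<integral>\<^sup>+x. ennreal (radial_density s' r x) \<partial>lborel)"
    by (rule nn_integral_cmult) simp
  also have "(\<integral>\<^sup>+x. ennreal (radial_density s' r x) \<partial>lborel) = 1"
    using T.emeasure_radial_total(2)[OF r] by (simp add: emeasure_density)
  finally show ?thesis by simp
qed

end

lemma nu_eq:
  assumes "0 < r"
  shows "nu r = density lborel (radial_density (1 / r) r)"
  unfolding nu_def
proof (rule density_cong)
  \<comment> \<open>At the origin the two densities differ, because
    \<open>0 powr 0 = 0\<close>.\<close>
  have "AE x in lborel. x \<noteq> (0::real)" by (rule AE_lborel_singleton)
  then show "AE x in lborel. ennreal (1 / (2 * Gamma (1 + 1 / r)) * exp (- (\<bar>x\<bar> powr r)))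
      = ennreal (radial_density (1 / r) r x)"
  proof eventually_elim
    case (elim x)
    have "Gamma (1 + 1 / r) = 1 / r * Gamma (1 / r)"
      using assms Gamma_plus1[of "1 / r"] nonpos_Ints_nonpos[of "1 / r"] by (auto simp: add.commute not_le)
    then show ?case
      using assms elim by (simp add: radial_density_def)
  qed
qed auto

lemma omega_eq: "omega \<alpha> = density lborel (radial_density 1 \<alpha>)"
  by (simp add: omega_def radial_density_def[abs_def])

lemma lam_eq: "lam s = density lborel (radial_density s 1)"
  by (simp add: lam_def radial_density_def[abs_def])

lemma radial_families:
  assumes "\<mu> \<in> {nu r | r. 0 < r \<and> r \<le> 1} \<union> {omega \<alpha> | \<alpha>. 0 < \<alpha>} \<union> {lam s | s. 1 \<le> s}"
  obtains s r where "1 \<le> s" "0 < r" "\<mu> = density lborel (radial_density s r)"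
proof -
  consider r where "0 < r" "r \<le> 1" "\<mu> = nu r" | \<alpha> where "0 < \<alpha>" "\<mu> = omega \<alpha>"
    | s where "1 \<le> s" "\<mu> = lam s"
    using assms by blast
  then show ?thesis
  proof cases
    case 1
    then show ?thesis using that[of "1 / r" r] nu_eq[of r] by simp
  next
    case 2
    then show ?thesis using that[of 1 \<alpha>] omega_eq by simp
  next
    case 3
    then show ?thesis using that[of s 1] lam_eq by simp
  qed
qed

section \<open>Comparison of moments\<close>

text \<open>Tonelli, after writing \<open>c powr p\<close> as the integral of
  \<open>p * s powr (p - 1)\<close> over the levels \<open>s\<close> below \<open>c\<close>.\<close>

lemma moment_eq_layer_cake:
  assumes "prob_space M" and X [measurable]: "X \<in> borel_measurable M"
    and nonneg: "\<And>x. 0 \<le> X x" and p: "0 < p"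
  shows "moment M X p = (\<integral>\<^sup>+s. ennreal (p * s powr (p - 1) * measure M {x \<in> space M. s < X x})
    * indicator {0<..} s \<partial>lborel)"
proof -
  interpret prob_space M by fact
  interpret P: pair_sigma_finite M "lborel :: real measure" ..
  have inner: "ennreal (c powr p) =
      (\<integral>\<^sup>+s. ennreal (p * s powr (p - 1)) * indicator {0<..} s * indicator {..<c} s \<partial>lborel)"
    if "0 \<le> c" for c
  proof -
    have "((\<lambda>s. p * s powr (p - 1)) has_integral p * (c powr (p - 1 + 1) / (p - 1 + 1))) {0..c}"
      using p that by (intro has_integral_mult_right has_integral_powr_from_0) auto
    then have "ennreal (c powr p) = (\<integral>\<^sup>+s. ennreal (p * s powr (p - 1)) * indicator {0..c} s \<partial>lborel)"
      using p by (subst nn_integral_has_integral_lebesgue') auto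
    also have "\<dots> = (\<integral>\<^sup>+s. ennreal (p * s powr (p - 1)) * indicator {0<..} s * indicator {..<c} s \<partial>lborel)"
    proof (rule nn_integral_cong_AE)
      have "AE s in lborel. s \<noteq> 0 \<and> s \<noteq> c"
        by (intro AE_conjI AE_lborel_singleton)
      then show "AE s in lborel. ennreal (p * s powr (p - 1)) * indicator {0..c} s =
          ennreal (p * s powr (p - 1)) * indicator {0<..} s * indicator {..<c} s"
        by eventually_elim (auto simp: indicator_def)
    qed
    finally show ?thesis .
  qed
  have "moment M X p = (\<integral>\<^sup>+x. \<integral>\<^sup>+s. ennreal (p * s powr (p - 1)) * indicator {0<..} s
      * indicator {s. s < X x} s \<partial>lborel \<partial>M)"
    unfolding moment_def using nonneg by (intro nn_integral_cong) (simp add: inner lessThan_def)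
  also have "\<dots> = (\<integral>\<^sup>+s. \<integral>\<^sup>+x. ennreal (p * s powr (p - 1)) * indicator {0<..} s
      * indicator {s. s < X x} s \<partial>M \<partial>lborel)"
    by (rule P.Fubini'[symmetric]) measurable
  also have "\<dots> = (\<integral>\<^sup>+s. ennreal (p * s powr (p - 1) * measure M {x \<in> space M. s < X x})
    * indicator {0<..} s \<partial>lborel)"
  proof (rule nn_integral_cong)
    fix s :: real
    have "(\<integral>\<^sup>+x. ennreal (p * s powr (p - 1)) * indicator {0<..} s * indicator {s. s < X x} s \<partial>M)
        = (\<integral>\<^sup>+x. ennreal (p * s powr (p - 1)) * indicator {0<..} s
          * indicator {x \<in> space M. s < X x} x \<partial>M)"
      by (intro nn_integral_cong) (auto simp: indicator_def)
    also have "\<dots> = ennreal (p * s powr (p - 1)) * indicator {0<..} s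
        * emeasure M {x \<in> space M. s < X x}"
      by (subst nn_integral_cmult) auto
    finally show "(\<integral>\<^sup>+x. ennreal (p * s powr (p - 1)) * indicator {0<..} s * indicator {s. s < X x} s \<partial>M)
        = ennreal (p * s powr (p - 1) * measure M {x \<in> space M. s < X x}) * indicator {0<..} s"
      using p by (simp add: emeasure_eq_measure ennreal_mult' mult_ac)
  qed
  finally show ?thesis .
qed

text \<open>Single crossing of the tails: up to the crossing point \<open>X\<close> has the heavier tail, beyond it the
  lighter one, and passing from the \<open>q\<close>-th to the \<open>p\<close>-th moment puts more weight on large values.\<close>

lemma moment_le_single_crossing:
  assumes M1: "prob_space M1" "X \<in> borel_measurable M1" "\<And>x. 0 \<le> X x"
    and M2: "prob_space M2" "Y \<in> borel_measurable M2" "\<And>x. 0 \<le> Y x"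
    and q: "0 < q" "q \<le> p"
    and eq: "moment M1 X q = moment M2 Y q" and fin: "moment M2 Y q < \<infinity>"
    and cross: "\<And>s t. 0 < s \<Longrightarrow> s \<le> t \<Longrightarrow>
      measure M1 {x \<in> space M1. s < X x} \<le> measure M2 {x \<in> space M2. s < Y x} \<Longrightarrow>
      measure M1 {x \<in> space M1. t < X x} \<le> measure M2 {x \<in> space M2. t < Y x}"
  shows "moment M1 X p \<le> moment M2 Y p"
proof -
  have p: "0 < p" using q by simp
  define F where "F s = measure M1 {x \<in> space M1. s < X x}" for s
  define G where "G s = measure M2 {x \<in> space M2. s < Y x}" for s
  have anti_meas: "f \<in> borel_measurable borel" if "antimono f" for f :: "real \<Rightarrow> real"
  proof -
    have "mono (\<lambda>x. - f x)" using that by (auto simp: mono_def antimono_def)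
    from borel_measurable_uminus[OF borel_measurable_mono[OF this]] show ?thesis by simp
  qed
  have [measurable]: "F \<in> borel_measurable borel"
    unfolding F_def by (intro anti_meas) (rule antimonoI, use M1 in 
      \<open>auto intro!: finite_measure.finite_measure_mono prob_space.finite_measure\<close>)
  have [measurable]: "G \<in> borel_measurable borel"
    unfolding G_def by (intro anti_meas) (rule antimonoI, use M2 in 
      \<open>auto intro!: finite_measure.finite_measure_mono prob_space.finite_measure\<close>)
  let ?I = "\<lambda>a H. \<integral>\<^sup>+s. ennreal (a * s powr (a - 1) * H s) * indicator {0<..} s \<partial>lborel"
  have mX: "moment M1 X a = ?I a F" and mY: "moment M2 Y a = ?I a G" if "0 < a" for a
    using moment_eq_layer_cake[OF M1 that] moment_eq_layer_cake[OF M2 that]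
    by (simp_all add: F_def G_def)
  have F0: "0 \<le> F s" and G0: "0 \<le> G s" for s by (simp_all add: F_def G_def)
  \<comment> \<open>The levels at which the tail of \<open>X\<close> is no heavier than that of
    \<open>Y\<close>. By \<open>cross\<close> they are closed upwards, and their infimum is the
    crossing point.\<close>
  define S where "S = {s. 0 < s \<and> F s \<le> G s}"
  show ?thesis
  proof (cases "S = {}")
    \<comment> \<open>Without a crossing the tail of \<open>X\<close> is strictly heavier at every
      positive level, against the equality of the finite \<open>q\<close>-th moments.\<close>
    case True
    then have lt: "G s < F s" if "0 < s" for s using that by (auto simp: S_def not_le[symmetric])
    have "?I q G < ?I q F"
    proof (rule nn_integral_less)
      show "?I q G \<noteq> \<infinity>" using fin mY[OF q(1)] by simp
      show "AE s in lborel. ennreal (q * s powr (q - 1) * G s) * indicator {0<..} s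
          \<le> ennreal (q * s powr (q - 1) * F s) * indicator {0<..} s"
        using less_imp_le[OF lt] q
        by (intro AE_I2) (auto simp: indicator_def intro!: ennreal_leI mult_left_mono)
      have "False" if "AE s in lborel. ennreal (q * s powr (q - 1) * F s) * indicator {0<..} s
          \<le> ennreal (q * s powr (q - 1) * G s) * indicator {0<..} s"
      proof -
        have "AE s in lborel. s \<notin> {0<..<1::real}"
          using that
        proof eventually_elim
          case (elim s)
          show ?case
          proof
            assume "s \<in> {0<..<1}"
            then have "q * s powr (q - 1) * F s \<le> q * s powr (q - 1) * G s"
              using elim q G0[of s] by (simp add: ennreal_le_iff)
            then show False using lt[of s] \<open>s \<in> {0<..<1}\<close> q by simp
          qed
        qed
        then have "emeasure lborel {0<..<1::real} = 0"
          by (subst (asm) AE_iff_measurable[OF _ refl]) (auto simp: greaterThanLessThan_def greaterThan_def lessThan_def Int_def)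
        then show False by simp
      qed
      then show "\<not> (AE s in lborel. ennreal (q * s powr (q - 1) * F s) * indicator {0<..} s
          \<le> ennreal (q * s powr (q - 1) * G s) * indicator {0<..} s)" by blast
    qed measurable
    then show ?thesis using eq mX[OF q(1)] mY[OF q(1)] by simp
  next
    case False
    define s0 where "s0 = Inf S"
    have bdd: "bdd_below S" by (rule bdd_belowI[of _ 0]) (auto simp: S_def)
    have s0: "0 \<le> s0" unfolding s0_def using False by (intro cInf_greatest) (auto simp: S_def)
    have above: "F s \<le> G s" if "s0 < s" for s
    proof -
      obtain u where "u \<in> S" "u < s"
        using cInf_lessD[OF False, of s] \<open>s0 < s\<close> unfolding s0_def by blast
      then show ?thesis using cross[of u s] by (auto simp: S_def F_def G_def)
    qed
    have below: "G s \<le> F s" if "0 < s" "s < s0" for s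
      using that cInf_lower[OF _ bdd, of s] by (force simp: S_def s0_def)
    \<comment> \<open>Chosen so that \<open>p * s powr (p - 1) - k * (q * s powr (q - 1))\<close> is
      nonpositive below \<open>s0\<close> and nonnegative above. So is \<open>G s - F s\<close>,
      hence the product is nonnegative.\<close>
    define k where "k = p / q * s0 powr (p - q)"
    have k0: "0 \<le> k" using p q by (simp add: k_def)
    have point: "p * s powr (p - 1) * F s + k * (q * s powr (q - 1) * G s)
        \<le> p * s powr (p - 1) * G s + k * (q * s powr (q - 1) * F s)" if s: "0 < s" "s \<noteq> s0" for s
    proof -
      have "0 \<le> (s powr (p - q) - s0 powr (p - q)) * (G s - F s)"
      proof (cases "s0 < s")
        case True
        then show ?thesis using above[OF True] s0 q by (intro mult_nonneg_nonneg) (auto intro: powr_mono2)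
      next
        case False
        then show ?thesis using below[of s] s q by (intro mult_nonpos_nonpos) (auto intro: powr_mono2)
      qed
      then have "0 \<le> p * s powr (q - 1) * ((s powr (p - q) - s0 powr (p - q)) * (G s - F s))"
        by (rule mult_nonneg_nonneg[rotated]) (use p in simp)
      also have "s powr (p - 1) = s powr (q - 1) * s powr (p - q)" by (simp flip: powr_add)
      then have "p * s powr (q - 1) * ((s powr (p - q) - s0 powr (p - q)) * (G s - F s))
          = (p * s powr (p - 1) * G s + k * (q * s powr (q - 1) * F s))
          - (p * s powr (p - 1) * F s + k * (q * s powr (q - 1) * G s))"
        using q by (simp add: k_def algebra_simps)
      finally show ?thesis by simp
    qed
    \<comment> \<open>Subtracted terms are kept on the other side of the inequality, because the
      \<open>p\<close>-th moments may be infinite; only the finite \<open>q\<close>-th moment is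
      cancelled at the end.\<close>
    have split: "?I p A + ennreal k * ?I q B = (\<integral>\<^sup>+s. ennreal (p * s powr (p - 1) * A s
        + k * (q * s powr (q - 1) * B s)) * indicator {0<..} s \<partial>lborel)"
      if [measurable]: "A \<in> borel_measurable borel" "B \<in> borel_measurable borel"
        and "\<And>s. 0 \<le> A s" "\<And>s. 0 \<le> B s" for A B :: "real \<Rightarrow> real"
    proof -
      have "?I p A + ennreal k * ?I q B = (\<integral>\<^sup>+s. ennreal (p * s powr (p - 1) * A s) * indicator {0<..} s
          + ennreal k * (ennreal (q * s powr (q - 1) * B s) * indicator {0<..} s) \<partial>lborel)"
        by (subst nn_integral_add) (auto simp: nn_integral_cmult)
      also have "\<dots> = (\<integral>\<^sup>+s. ennreal (p * s powr (p - 1) * A s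
        + k * (q * s powr (q - 1) * B s)) * indicator {0<..} s \<partial>lborel)"
        using p q k0 that(3,4)
        by (intro nn_integral_cong) (auto simp: indicator_def ennreal_plus ennreal_mult)
      finally show ?thesis .
    qed
    have "?I p F + ennreal k * ?I q G \<le> ?I p G + ennreal k * ?I q F"
      unfolding split[OF \<open>F \<in> _\<close> \<open>G \<in> _\<close> F0 G0] split[OF \<open>G \<in> _\<close> \<open>F \<in> _\<close> G0 F0]
    proof (rule nn_integral_mono_AE)
      have "AE s in lborel. s \<noteq> s0" by (rule AE_lborel_singleton)
      then show "AE s in lborel. ennreal (p * s powr (p - 1) * F s + k * (q * s powr (q - 1) * G s))
          * indicator {0<..} s
          \<le> ennreal (p * s powr (p - 1) * G s + k * (q * s powr (q - 1) * F s)) * indicator {0<..} s"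
        by eventually_elim (auto simp: indicator_def intro!: ennreal_leI point)
    qed
    then have "moment M1 X p + ennreal k * moment M2 Y q \<le> moment M2 Y p + ennreal k * moment M2 Y q"
      using mX[OF p] mY[OF p] mX[OF q(1)] mY[OF q(1)] eq by simp
    moreover have "ennreal k * moment M2 Y q < \<infinity>"
      using fin by (simp add: ennreal_mult_less_top)
    ultimately show ?thesis
      by (auto simp: ennreal_add_left_cancel_le add.commute)
  qed
qed

section \<open>Unconditional norms and crude bounds for their moments\<close>

lemma
  assumes "is_norm N"
  shows is_norm_nonneg: "0 \<le> N x"
    and is_norm_zero: "N 0 = 0"
    and is_norm_pos: "x \<noteq> 0 \<Longrightarrow> 0 < N x"
    and is_norm_scaleR: "N (a *\<^sub>R x) = \<bar>a\<bar> * N x"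
    and is_norm_triangle: "N (x + y) \<le> N x + N y"
  using assms unfolding is_norm_def by (auto simp: less_le)

lemma is_norm_sum_le:
  assumes "is_norm N" "finite A"
  shows "N (\<Sum>i\<in>A. f i) \<le> (\<Sum>i\<in>A. N (f i))"
  using assms(2)
proof induction
  case empty
  then show ?case using is_norm_zero[OF assms(1)] by simp
next
  case (insert i A)
  then show ?case
    by (auto intro: order_trans[OF is_norm_triangle[OF assms(1)] add_left_mono])
qed

lemma is_norm_le_coordinates:
  fixes x :: "real ^ 'n::finite"
  assumes "is_norm N"
  shows "N x \<le> (\<Sum>i\<in>UNIV. \<bar>x $ i\<bar> * N (axis i 1))"
proof -
  have "N x = N (\<Sum>i\<in>UNIV. (x $ i) *\<^sub>R axis i 1)"
    using basis_expansion[of x] by (simp add: scalar_mult_eq_scaleR)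
  also have "\<dots> \<le> (\<Sum>i\<in>UNIV. N ((x $ i) *\<^sub>R axis i 1))"
    by (rule is_norm_sum_le[OF assms]) simp
  also have "\<dots> = (\<Sum>i\<in>UNIV. \<bar>x $ i\<bar> * N (axis i 1))"
    by (simp add: is_norm_scaleR[OF assms])
  finally show ?thesis .
qed

text \<open>A norm is convex, hence continuous on a finite-dimensional space.\<close>

lemma measurable_is_norm:
  fixes N :: "real ^ 'n::finite \<Rightarrow> real"
  assumes "is_norm N"
  shows "N \<in> borel_measurable borel"
proof (rule borel_measurable_continuous_onI, rule convex_on_continuous)
  show "convex_on UNIV N"
  proof (rule convex_onI)
    fix t :: real and x y :: "real ^ 'n" assume "0 < t" "t < 1"
    have "N ((1 - t) *\<^sub>R x + t *\<^sub>R y) \<le> N ((1 - t) *\<^sub>R x) + N (t *\<^sub>R y)"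
      by (rule is_norm_triangle[OF assms])
    also have "\<dots> = (1 - t) * N x + t * N y"
      using \<open>0 < t\<close> \<open>t < 1\<close> by (simp add: is_norm_scaleR[OF assms])
    finally show "N ((1 - t) *\<^sub>R x + t *\<^sub>R y) \<le> (1 - t) * N x + t * N y" .
  qed simp
qed simp

text \<open>The changed vector is a convex combination of \<open>x\<close> and its reflection in
  coordinate \<open>i\<close>, where the norm takes the same value.\<close>

lemma unconditional_norm_coordinate_le:
  fixes x :: "real ^ 'n::finite"
  assumes N: "is_norm N" "unconditional N" and a: "\<bar>a\<bar> \<le> \<bar>x $ i\<bar>"
  shows "N (\<chi> k. if k = i then a else x $ k) \<le> N x"
proof -
  define x' where "x' = (\<chi> k. (if k = i then - 1 else 1) * x $ k)"
  \<comment> \<open>The weight solves \<open>a = l * x $ i - (1 - l) * x $ i\<close>. If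
    \<open>x $ i = 0\<close>, then \<open>a = 0\<close>, and division by zero gives the harmless
    weight 1/2.\<close>
  define l where "l = (1 + a / x $ i) / 2"
  have "\<bar>a / x $ i\<bar> \<le> 1" using a by (simp add: abs_divide divide_le_eq)
  then have "- 1 \<le> a / x $ i" "a / x $ i \<le> 1" unfolding abs_le_iff by linarith+
  then have l: "0 \<le> l" "l \<le> 1" by (simp_all add: l_def)
  have "N x' = N x"
    using N(2)[unfolded unconditional_def, rule_format, of "\<lambda>k. if k = i then - 1 else 1" x]
    by (simp add: x'_def)
  have "(\<chi> k. if k = i then a else x $ k) = l *\<^sub>R x + (1 - l) *\<^sub>R x'"
  proof (intro vec_eq_iff[THEN iffD2] allI)
    fix k
    have "a = l * x $ i - (1 - l) * x $ i"
      using a by (cases "x $ i = 0") (auto simp: l_def field_simps)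
    then show "(\<chi> k. if k = i then a else x $ k) $ k = (l *\<^sub>R x + (1 - l) *\<^sub>R x') $ k"
      by (auto simp: x'_def algebra_simps)
  qed
  also have "N (l *\<^sub>R x + (1 - l) *\<^sub>R x') \<le> N (l *\<^sub>R x) + N ((1 - l) *\<^sub>R x')"
    by (rule is_norm_triangle[OF N(1)])
  also have "\<dots> = l * N x + (1 - l) * N x'"
    using l by (simp add: is_norm_scaleR[OF N(1)])
  also have "\<dots> = N x" using \<open>N x' = N x\<close> by (simp add: algebra_simps)
  finally show ?thesis .
qed

text \<open>Replaces the coordinates one at a time. This is what makes the balls of an unconditional
  norm ideals.\<close>

lemma unconditional_norm_mono:
  fixes x y :: "real ^ 'n::finite"
  assumes N: "is_norm N" "unconditional N" and le: "\<And>i. \<bar>y $ i\<bar> \<le> \<bar>x $ i\<bar>"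
  shows "N y \<le> N x"
proof -
  have "N (\<chi> k. if k \<in> A then y $ k else x $ k) \<le> N x" if "finite A" for A
    using that
  proof induction
    case empty
    then show ?case by simp
  next
    case (insert i A)
    let ?z = "\<chi> k. if k \<in> A then y $ k else x $ k"
    have "(\<chi> k. if k \<in> insert i A then y $ k else x $ k) = (\<chi> k. if k = i then y $ i else ?z $ k)"
      by (auto simp: vec_eq_iff)
    also have "N \<dots> \<le> N ?z"
      by (rule unconditional_norm_coordinate_le[OF N]) (use insert le in simp)
    finally show ?case using insert by simp
  qed
  from this[of UNIV] show ?thesis by simp
qed

lemma nn_integral_power_measure_component:
  fixes \<mu> :: "real measure" and j :: "'n::finite"
  assumes "prob_space \<mu>" "sets \<mu> = sets borel" and g: "g \<in> borel_measurable borel"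
  shows "(\<integral>\<^sup>+x. g (x $ j) \<partial>power_measure \<mu>) = (\<integral>\<^sup>+x. g x \<partial>\<mu>)"
proof -
  have "(\<lambda>x :: real ^ 'n. x $ j) \<in> power_measure \<mu> \<rightarrow>\<^sub>M \<mu>"
    by (subst measurable_cong_sets[OF sets_power_measure assms(2)]) simp
  moreover have "g \<in> borel_measurable \<mu>"
    using g by (simp add: measurable_cong_sets[OF assms(2) refl])
  ultimately have "(\<integral>\<^sup>+x. g x \<partial>distr (power_measure \<mu>) \<mu> (\<lambda>x. x $ j)) = (\<integral>\<^sup>+x. g (x $ j) \<partial>power_measure \<mu>)"
    by (intro nn_integral_distr) simp_all
  then show ?thesis by (simp add: distr_power_measure_component[OF assms(1,2)])
qed

text \<open>Any constant will do: the bound serves to make a moment of the norm finite, or zero,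
  when the corresponding moment of \<open>\<mu>\<close> is. It bounds \<open>N x\<close> by the
  largest term of the coordinate expansion.\<close>

lemma moment_norm_le:
  fixes N :: "real ^ 'n::finite \<Rightarrow> real" and \<mu> :: "real measure"
  assumes N: "is_norm N" and \<mu>: "prob_space \<mu>" "sets \<mu> = sets borel" and p: "0 < p"
  obtains C where "0 \<le> C" "moment (power_measure \<mu>) N p \<le> ennreal C * moment \<mu> abs p"
proof -
  define n where "n i = real CARD('n) * N (axis i 1)" for i :: 'n
  have n0: "0 \<le> n i" for i by (simp add: n_def is_norm_nonneg[OF N])
  have le: "N x powr p \<le> (\<Sum>i\<in>UNIV. n i powr p * \<bar>x $ i\<bar> powr p)" for x
  proof -
    define m where "m = Max (range (\<lambda>i. \<bar>x $ i\<bar> * N (axis i 1)))"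
    have "m \<in> range (\<lambda>i. \<bar>x $ i\<bar> * N (axis i 1))" unfolding m_def by (rule Max_in) auto
    then obtain i where i: "m = \<bar>x $ i\<bar> * N (axis i 1)" by blast
    have "N x \<le> (\<Sum>i\<in>UNIV. \<bar>x $ i\<bar> * N (axis i 1))" by (rule is_norm_le_coordinates[OF N])
    also have "\<dots> \<le> of_nat CARD('n) * m"
      by (rule sum_bounded_above) (auto simp: m_def)
    also have "\<dots> = n i * \<bar>x $ i\<bar>" by (simp add: i n_def)
    finally have "N x powr p \<le> (n i * \<bar>x $ i\<bar>) powr p"
      using is_norm_nonneg[OF N] p by (intro powr_mono2) auto
    also have "\<dots> = n i powr p * \<bar>x $ i\<bar> powr p" using n0 by (simp add: powr_mult)
    also have "\<dots> \<le> (\<Sum>i\<in>UNIV. n i powr p * \<bar>x $ i\<bar> powr p)"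
      by (rule member_le_sum) auto
    finally show ?thesis .
  qed
  have "moment (power_measure \<mu>) N p
      \<le> (\<integral>\<^sup>+x. (\<Sum>i\<in>UNIV. ennreal (n i powr p) * ennreal (\<bar>x $ i\<bar> powr p)) \<partial>power_measure \<mu>)"
    unfolding moment_def
  proof (rule nn_integral_mono)
    fix x :: "real ^ 'n"
    have "(\<Sum>i\<in>UNIV. ennreal (n i powr p) * ennreal (\<bar>x $ i\<bar> powr p))
        = ennreal (\<Sum>i\<in>UNIV. n i powr p * \<bar>x $ i\<bar> powr p)"
      by (simp add: ennreal_mult[symmetric] sum_ennreal)
    then show "ennreal (N x powr p) \<le> (\<Sum>i\<in>UNIV. ennreal (n i powr p) * ennreal (\<bar>x $ i\<bar> powr p))"
      using le[of x] by (simp add: ennreal_leI)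
  qed
  also have "\<dots> = (\<Sum>i\<in>UNIV. \<integral>\<^sup>+x. ennreal (n i powr p) * ennreal (\<bar>x $ i\<bar> powr p) \<partial>power_measure \<mu>)"
    by (rule nn_integral_sum) measurable
  also have "\<dots> = (\<Sum>i\<in>(UNIV :: 'n set). ennreal (n i powr p) * moment \<mu> abs p)"
  proof (rule sum.cong[OF refl])
    fix i :: 'n
    have "(\<integral>\<^sup>+x. ennreal (n i powr p) * ennreal (\<bar>x $ i\<bar> powr p) \<partial>power_measure \<mu>)
        = (\<integral>\<^sup>+x. ennreal (n i powr p) * ennreal (\<bar>x\<bar> powr p) \<partial>\<mu>)"
      by (rule nn_integral_power_measure_component[OF \<mu>]) simp
    also have "\<dots> = ennreal (n i powr p) * moment \<mu> abs p"
      unfolding moment_def by (rule nn_integral_cmult)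
        (simp add: measurable_cong_sets[OF \<mu>(2) refl])
    finally show "(\<integral>\<^sup>+x. ennreal (n i powr p) * ennreal (\<bar>x $ i\<bar> powr p) \<partial>power_measure \<mu>)
        = ennreal (n i powr p) * moment \<mu> abs p" .
  qed
  also have "\<dots> = ennreal (\<Sum>i\<in>UNIV. n i powr p) * moment \<mu> abs p"
    by (simp add: sum_distrib_right[symmetric])
  finally show ?thesis
    using that[of "\<Sum>i\<in>UNIV. n i powr p"] by (simp add: sum_nonneg)
qed

text \<open>By monotonicity \<open>x\<close> is compared with its projection to one axis, chosen
  arbitrarily. The bound keeps the moment of the norm positive.\<close>

lemma moment_norm_ge:
  fixes N :: "real ^ 'n::finite \<Rightarrow> real" and \<mu> :: "real measure"
  assumes N: "is_norm N" "unconditional N" and \<mu>: "prob_space \<mu>" "sets \<mu> = sets borel" and p: "0 < p"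
  obtains C where "0 < C" "ennreal C * moment \<mu> abs p \<le> moment (power_measure \<mu>) N p"
proof -
  fix i :: 'n
  have "axis i (1::real) \<noteq> 0" by (simp add: axis_eq_0_iff)
  then have pos: "0 < N (axis i 1)" by (rule is_norm_pos[OF N(1)])
  have le: "N (axis i 1) powr p * \<bar>x $ i\<bar> powr p \<le> N x powr p" for x
  proof -
    have "N (axis i 1) * \<bar>x $ i\<bar> = N ((x $ i) *\<^sub>R axis i 1)"
      by (simp add: is_norm_scaleR[OF N(1)])
    also have "\<dots> \<le> N x"
      by (rule unconditional_norm_mono[OF N]) (auto simp: axis_def)
    finally have "(N (axis i 1) * \<bar>x $ i\<bar>) powr p \<le> N x powr p"
      using pos p by (intro powr_mono2) auto
    then show ?thesis using pos by (simp add: powr_mult)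
  qed
  have "ennreal (N (axis i 1) powr p) * moment \<mu> abs p
      = (\<integral>\<^sup>+x. ennreal (N (axis i 1) powr p) * ennreal (\<bar>x\<bar> powr p) \<partial>\<mu>)"
    unfolding moment_def by (rule nn_integral_cmult[symmetric])
      (simp add: measurable_cong_sets[OF \<mu>(2) refl])
  also have "\<dots> = (\<integral>\<^sup>+x. ennreal (N (axis i 1) powr p) * ennreal (\<bar>x $ i\<bar> powr p) \<partial>power_measure \<mu>)"
    by (rule nn_integral_power_measure_component[OF \<mu>, symmetric]) simp
  also have "\<dots> \<le> moment (power_measure \<mu>) N p"
    unfolding moment_def
    by (intro nn_integral_mono) (simp add: ennreal_mult[symmetric] ennreal_leI le)
  finally show thesis using that[of "N (axis i 1) powr p"] pos by simp
qed

text \<open>The open slab of half-width \<open>w\<close> is an ideal. If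
  \<open>\<bar>x\<bar> = w\<close> is null, it has the measure of the closed strip, and dilating
  both by \<open>a / w\<close> bounds the measure of the closed strip of half-width \<open>a\<close>
  by that of the open one.\<close>

lemma S_inequality_imp_no_atoms:
  fixes j :: "'n::finite"
  assumes \<mu>: "prob_space \<mu>" "sets \<mu> = sets borel"
    and S: "supports_S_inequality_ideals j (power_measure \<mu>)" and a: "0 < a"
  shows "measure \<mu> {x. \<bar>x\<bar> = a} = 0"
proof -
  interpret prob_space \<mu> by fact
  have [measurable_cong, simp]: "sets \<mu> = sets borel" by fact
  have [simp]: "space \<mu> = UNIV" using sets_eq_imp_space_eq[OF \<mu>(2)] by simp
  let ?M = "power_measure \<mu> :: (real ^ 'n) measure"
  define D where "D = distr \<mu> borel abs"
  interpret D: real_distribution D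
    unfolding D_def real_distribution_def real_distribution_axioms_def
    by (auto intro: prob_space_distr)
  have D_atom: "measure D {w} = measure \<mu> {x. \<bar>x\<bar> = w}" for w
    unfolding D_def by (subst measure_distr) (auto simp: vimage_def)
  \<comment> \<open>Atoms are countable, so some positive level \<open>w\<close> below
    \<open>a\<close> carries none.\<close>
  have "uncountable ({0<..<a} - {w. measure D {w} \<noteq> 0})"
    using a D.countable_support by (simp add: uncountable_minus_countable uncountable_open_interval)
  then have "{0<..<a} - {w. measure D {w} \<noteq> 0} \<noteq> {}" by (metis countable_empty)
  then obtain w where w: "0 < w" "w < a" "measure D {w} = 0" by auto
  define L where "L = {x :: real ^ 'n. \<bar>x $ j\<bar> < w}"
  have dil: "dilate t L = {x. x $ j \<in> {u. \<bar>u\<bar> < t * w}}" if "0 < t" for t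
    using that by (auto simp: dilate_eq_vimage L_def field_simps abs_mult)
  have "L \<in> sets borel" unfolding L_def by measurable
  moreover have "is_ideal L" unfolding is_ideal_iff by (auto simp: L_def intro: le_less_trans)
  ultimately have "supports_S_inequality j ?M L"
    using S by (auto simp: supports_S_inequality_ideals_def)
  moreover have "measure ?M (dilate 1 L) = measure ?M (strip j w)"
  proof -
    have "measure ?M (strip j w) = measure \<mu> {u. \<bar>u\<bar> \<le> w}"
      using measure_power_measure_component[OF \<mu>, of "{u. \<bar>u\<bar> \<le> w}" j] by (simp add: strip_def)
    also have "{u. \<bar>u\<bar> \<le> w} = {u. \<bar>u\<bar> < w} \<union> {u. \<bar>u\<bar> = w}" by auto
    also have "measure \<mu> \<dots> = measure \<mu> {u. \<bar>u\<bar> < w} + measure \<mu> {u. \<bar>u\<bar> = w}"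
      by (rule finite_measure_Union) auto
    also have "\<dots> = measure \<mu> {u. \<bar>u\<bar> < w}" using w(3) by (simp add: D_atom)
    finally show ?thesis
      using measure_power_measure_component[OF \<mu>, of "{u. \<bar>u\<bar> < w}" j] by (simp add: dil)
  qed
  ultimately have "measure ?M (dilate (a / w) (strip j w)) \<le> measure ?M (dilate (a / w) (dilate 1 L))"
    using w unfolding supports_S_inequality_def by simp
  moreover have "dilate 1 L = L" by (simp add: dilate_def)
  ultimately have "measure ?M {x. x $ j \<in> {u. \<bar>u\<bar> \<le> a}} \<le> measure ?M {x. x $ j \<in> {u. \<bar>u\<bar> < a}}"
    using w a by (simp add: dil dilate_strip) (simp add: strip_def)
  then have "measure \<mu> {u. \<bar>u\<bar> \<le> a} \<le> measure \<mu> {u. \<bar>u\<bar> < a}"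
    using measure_power_measure_component[OF \<mu>, of "{u. \<bar>u\<bar> \<le> a}" j]
      measure_power_measure_component[OF \<mu>, of "{u. \<bar>u\<bar> < a}" j] by simp
  moreover have "measure \<mu> {u. \<bar>u\<bar> \<le> a} = measure \<mu> {u. \<bar>u\<bar> < a} + measure \<mu> {u. \<bar>u\<bar> = a}"
    by (subst finite_measure_Union[symmetric]) (auto intro!: arg_cong[where f="measure \<mu>"])
  ultimately show ?thesis using measure_nonneg[of \<mu> "{x. \<bar>x\<bar> = a}"] by linarith
qed

text \<open>The hypothesis says that the ball of radius \<open>s\<close> has at least the measure of
  the strip of half-width \<open>s / c\<close>. In the absence of atoms some strip of half-width
  \<open>w \<ge> s / c\<close> has exactly the measure of the ball. The S-inequality with dilation
  \<open>t / s\<close> then bounds the ball of radius \<open>t\<close> below by the strip of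
  half-width \<open>t / s * w\<close>, which is at least \<open>t / c\<close>.\<close>

lemma S_inequality_norm_crossing:
  fixes j :: "'n::finite" and N :: "real ^ 'n \<Rightarrow> real"
  assumes \<mu>: "prob_space \<mu>" "sets \<mu> = sets borel"
    and S: "supports_S_inequality_ideals j (power_measure \<mu>)"
    and N: "is_norm N" "unconditional N" and s: "0 < s" "s \<le> t" and c: "0 < c"
    and le: "measure (power_measure \<mu>) {x. s < N x} \<le> measure \<mu> {x. s < c * \<bar>x\<bar>}"
  shows "measure (power_measure \<mu>) {x. t < N x} \<le> measure \<mu> {x. t < c * \<bar>x\<bar>}"
proof -
  interpret prob_space \<mu> by fact
  have [measurable_cong, simp]: "sets \<mu> = sets borel" by fact
  have [simp]: "space \<mu> = UNIV" using sets_eq_imp_space_eq[OF \<mu>(2)] by simp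
  let ?M = "power_measure \<mu> :: (real ^ 'n) measure"
  interpret M: prob_space ?M by (rule prob_space_power_measure[OF \<mu>])
  note [measurable] = measurable_is_norm[OF N(1)]
  define D where "D = distr \<mu> borel abs"
  interpret D: real_distribution D
    unfolding D_def real_distribution_def real_distribution_axioms_def
    by (auto intro: prob_space_distr)
  have D_cdf: "cdf D w = measure \<mu> {x. \<bar>x\<bar> \<le> w}" for w
    unfolding D_def cdf_def by (subst measure_distr) (auto simp: vimage_def)
  have D_cont: "isCont (cdf D) w" if "0 < w" for w
  proof -
    have "measure D {w} = measure \<mu> {x. \<bar>x\<bar> = w}"
      unfolding D_def by (subst measure_distr) (auto simp: vimage_def)
    then show ?thesis using S_inequality_imp_no_atoms[OF \<mu> S that] by (simp add: D.isCont_cdf)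
  qed
  have D_compl: "measure \<mu> {x. u < c * \<bar>x\<bar>} = 1 - cdf D (u / c)" for u
  proof -
    have "{x. u < c * \<bar>x\<bar>} = UNIV - {x. \<bar>x\<bar> \<le> u / c}" using c by (auto simp: field_simps)
    then show ?thesis using prob_compl[of "{x. \<bar>x\<bar> \<le> u / c}"] by (simp add: D_cdf)
  qed
  have N_compl: "measure ?M {x. u < N x} = 1 - measure ?M {x. N x \<le> u}" for u
  proof -
    have "{x. u < N x} = UNIV - {x. N x \<le> u}" by auto
    then show ?thesis using M.prob_compl[of "{x. N x \<le> u}"] by simp
  qed
  define v where "v = measure ?M {x. N x \<le> s}"
  have v: "cdf D (s / c) \<le> v" using le by (simp add: v_def D_compl N_compl)
  show ?thesis
  \<comment> \<open>A strip of measure 1 need not exist, so a ball of full measure is treated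
    separately; the larger ball then has full measure too.\<close>
  proof (cases "v = 1")
    case True
    have "v \<le> measure ?M {x. N x \<le> t}"
      unfolding v_def using s by (intro M.finite_measure_mono) auto
    then have "measure ?M {x. t < N x} \<le> 0" using True by (simp add: N_compl)
    then show ?thesis using measure_nonneg[of \<mu>] order_trans by blast
  next
    case False
    then have "v < 1" using M.prob_le_1 by (simp add: v_def less_le)
    then have "\<forall>\<^sub>F b in at_top. v < cdf D b \<and> s / c \<le> b"
      using order_tendstoD(1)[OF D.cdf_lim_at_top_prob] eventually_ge_at_top
      by (intro eventually_conj) auto
    then obtain b where b: "v < cdf D b" "s / c \<le> b"
      using eventually_happens by fastforce
    have "continuous_on {s / c..b} (cdf D)"
      using s c by (intro continuous_at_imp_continuous_on ballI D_cont) (auto intro: less_le_trans[rotated])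
    then obtain w where w: "s / c \<le> w" "cdf D w = v"
      using IVT'[of "cdf D" "s / c" v b] v b by auto
    define L where "L = {x. N x \<le> s}"
    have dil: "dilate u L = {x. N x \<le> u * s}" if "0 < u" for u
      using that by (auto simp: dilate_eq_vimage L_def is_norm_scaleR[OF N(1)] field_simps)
    have "L \<in> sets borel" unfolding L_def by measurable
    moreover have "is_ideal L"
      unfolding is_ideal_iff
      by (auto simp: L_def intro: order_trans[OF unconditional_norm_mono[OF N]])
    ultimately have "supports_S_inequality j ?M L"
      using S by (auto simp: supports_S_inequality_ideals_def)
    moreover have strip: "measure ?M (strip j u) = cdf D u" for u
      using measure_power_measure_component[OF \<mu>, of "{x. \<bar>x\<bar> \<le> u}" j] by (simp add: strip_def D_cdf)
    have "0 \<le> w" using w s c by (meson divide_nonneg_pos less_imp_le order_trans)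
    moreover have "measure ?M (dilate 1 L) = measure ?M (strip j w)"
      by (simp add: dil strip w v_def)
    ultimately have "measure ?M (dilate (t / s) (strip j w)) \<le> measure ?M (dilate (t / s) (dilate 1 L))"
      using s unfolding supports_S_inequality_def by simp
    moreover have "dilate 1 L = L" by (simp add: dilate_def)
    ultimately have "cdf D (t / s * w) \<le> measure ?M {x. N x \<le> t}"
      using s by (simp add: dil dilate_strip strip)
    moreover have "cdf D (t / c) \<le> cdf D (t / s * w)"
      using w(1) s c by (intro D.cdf_nondecreasing) (simp add: field_simps)
    ultimately show ?thesis by (simp add: D_compl N_compl)
  qed
qed

section \<open>The moment inequality for norms and the optimality of its constant\<close>

lemma ennreal_powr_ennreal: "0 \<le> x \<Longrightarrow> ennreal_powr (ennreal x) a = ennreal (x powr a)"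
  by (simp add: ennreal_powr_def)

lemma ennreal_powr_mono:
  assumes "x \<le> y" "0 \<le> a"
  shows "ennreal_powr x a \<le> ennreal_powr y a"
proof (cases y)
  case (real r)
  with assms(1) obtain u where "x = ennreal u" "0 \<le> u" "u \<le> r"
    by (cases x) (auto simp: top_unique)
  then show ?thesis
    using real assms(2) by (auto simp: ennreal_powr_ennreal intro!: ennreal_leI powr_mono2)
qed (simp add: ennreal_powr_def)

text \<open>Scaling \<open>\<bar>x\<bar>\<close> by the factor \<open>c\<close> that equalises the
  \<open>q\<close>-th moments reduces the claim to the single crossing of tails supplied by the
  S-inequality.\<close>

lemma moment_comparison:
  fixes j :: "'n::finite" and N :: "real ^ 'n \<Rightarrow> real"
  assumes \<mu>: "prob_space \<mu>" "sets \<mu> = sets borel"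
    and S: "supports_S_inequality_ideals j (power_measure \<mu>)"
    and N: "is_norm N" "unconditional N" and q: "0 < q" "q \<le> p"
    and fin: "moment \<mu> abs q < \<infinity>"
  shows "ennreal_powr (moment (power_measure \<mu>) N p) (1 / p)
    \<le> moment_constant \<mu> p q * ennreal_powr (moment (power_measure \<mu>) N q) (1 / q)"
proof -
  have p: "0 < p" using q by simp
  have abs_meas [measurable]: "abs \<in> borel_measurable \<mu>" "(\<lambda>x. \<bar>x\<bar> powr a) \<in> borel_measurable \<mu>" for a :: real
    by (simp_all add: measurable_cong_sets[OF \<mu>(2) refl])
  obtain C where C: "0 \<le> C" "moment (power_measure \<mu>) N q \<le> ennreal C * moment \<mu> abs q"
    by (rule moment_norm_le[OF N(1) \<mu> q(1)])
  have "ennreal C * moment \<mu> abs q < \<infinity>" using fin by (simp add: ennreal_mult_less_top)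
  with C have "moment (power_measure \<mu>) N q < \<infinity>" by (auto intro: le_less_trans)
  then obtain a where a: "0 \<le> a" "moment (power_measure \<mu>) N q = ennreal a"
    by (cases "moment (power_measure \<mu>) N q") auto
  obtain b where b: "0 \<le> b" "moment \<mu> abs q = ennreal b"
    using fin by (cases "moment \<mu> abs q") auto
  show ?thesis
  proof (cases "b = 0")
    \<comment> \<open>Here \<open>\<mu>\<close> is concentrated at the origin, and the left-hand
      side is 0.\<close>
    case True
    then have "AE x in \<mu>. ennreal (\<bar>x\<bar> powr q) = 0"
      using b by (subst nn_integral_0_iff_AE[symmetric]) (simp_all add: moment_def)
    then have "AE x in \<mu>. ennreal (\<bar>x\<bar> powr p) = 0" by eventually_elim simp
    then have "moment \<mu> abs p = 0" unfolding moment_def by (subst nn_integral_0_iff_AE) auto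
    moreover obtain C' where "0 \<le> C'" "moment (power_measure \<mu>) N p \<le> ennreal C' * moment \<mu> abs p"
      by (rule moment_norm_le[OF N(1) \<mu> p])
    ultimately have "moment (power_measure \<mu>) N p = 0" by simp
    then show ?thesis by (simp add: ennreal_powr_def)
  next
    case False
    with b have "0 < b" by simp
    obtain C' where C': "0 < C'" "ennreal C' * moment \<mu> abs q \<le> moment (power_measure \<mu>) N q"
      by (rule moment_norm_ge[OF N \<mu> q(1)])
    \<comment> \<open>Positivity of this moment makes the scaling factor \<open>c\<close> positive,
      as the crossing of tails requires.\<close>
    have "0 < a"
    proof (rule ccontr)
      assume "\<not> 0 < a"
      then have "ennreal C' * ennreal b = 0" using C' a b by simp
      then show False using C'(1) \<open>0 < b\<close> by (simp add: ennreal_mult[symmetric])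
    qed
    define c where "c = (a / b) powr (1 / q)"
    have "0 < c" using \<open>0 < a\<close> \<open>0 < b\<close> by (simp add: c_def)
    have scaled: "moment \<mu> (\<lambda>x. c * \<bar>x\<bar>) e = ennreal (c powr e) * moment \<mu> abs e" for e
      unfolding moment_def using \<open>0 < c\<close>
      by (subst nn_integral_cmult[symmetric]) (auto simp: powr_mult ennreal_mult)
    have c_q: "c powr q = a / b" using q \<open>0 < a\<close> \<open>0 < b\<close> by (simp add: c_def powr_powr)
    have "moment (power_measure \<mu>) N p \<le> moment \<mu> (\<lambda>x. c * \<bar>x\<bar>) p"
    proof (rule moment_le_single_crossing[OF _ _ _ \<mu>(1) _ _ q])
      show "prob_space (power_measure \<mu> :: (real ^ 'n) measure)" by (rule prob_space_power_measure[OF \<mu>])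
      show "N \<in> borel_measurable (power_measure \<mu>)"
        using measurable_is_norm[OF N(1)] by (simp add: measurable_cong_sets[OF sets_power_measure refl])
      show "0 \<le> N x" for x by (rule is_norm_nonneg[OF N(1)])
      show "moment (power_measure \<mu>) N q = moment \<mu> (\<lambda>x. c * \<bar>x\<bar>) q"
        using \<open>0 < b\<close> \<open>0 < a\<close> by (simp add: scaled a b c_q flip: ennreal_mult)
      show "moment \<mu> (\<lambda>x. c * \<bar>x\<bar>) q < \<infinity>"
        by (simp add: scaled b ennreal_mult_less_top)
      have sp: "space \<mu> = UNIV"
        using sets_eq_imp_space_eq[OF \<mu>(2)] by simp
      show "measure (power_measure \<mu>) {x \<in> space (power_measure \<mu>). t < N x}
          \<le> measure \<mu> {x \<in> space \<mu>. t < c * \<bar>x\<bar>}"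
        if "0 < s" "s \<le> t" "measure (power_measure \<mu>) {x \<in> space (power_measure \<mu>). s < N x}
          \<le> measure \<mu> {x \<in> space \<mu>. s < c * \<bar>x\<bar>}" for s t
        using S_inequality_norm_crossing[OF \<mu> S N that(1,2) \<open>0 < c\<close>] that(3) by (simp add: sp)
    qed (use \<open>0 < c\<close> in auto)
    then have le: "moment (power_measure \<mu>) N p \<le> ennreal (c powr p) * moment \<mu> abs p"
      by (simp add: scaled)
    show ?thesis
    proof (cases "moment \<mu> abs p")
      case (real B)
      have "ennreal_powr (moment (power_measure \<mu>) N p) (1 / p) \<le> ennreal_powr (ennreal (c powr p * B)) (1 / p)"
        using le real p by (intro ennreal_powr_mono) (simp_all add: ennreal_mult)
      also have "\<dots> = ennreal (c * B powr (1 / p))"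
        using real p \<open>0 < c\<close> by (simp add: ennreal_powr_ennreal powr_mult powr_powr)
      also have "c * B powr (1 / p) = B powr (1 / p) / b powr (1 / q) * a powr (1 / q)"
        using \<open>0 < a\<close> \<open>0 < b\<close> by (simp add: c_def powr_divide)
      also have "ennreal \<dots> = moment_constant \<mu> p q * ennreal_powr (moment (power_measure \<mu>) N q) (1 / q)"
        using \<open>0 < a\<close> \<open>0 < b\<close> real
        by (simp add: moment_constant_def a b ennreal_powr_ennreal divide_ennreal ennreal_mult[symmetric])
      finally show ?thesis .
    next
      case top
      \<comment> \<open>The constant is infinite, and so is the right-hand side because
        \<open>a\<close> is positive.\<close>
      then have "moment_constant \<mu> p q = \<infinity>"
        using b by (simp add: moment_constant_def ennreal_powr_ennreal) (simp add: ennreal_powr_def ennreal_divide_eq_top_iff)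
      then show ?thesis
        using a \<open>0 < a\<close> by (simp add: ennreal_powr_ennreal ennreal_top_mult)
    qed
  qed
qed

text \<open>The seminorm \<open>\<bar>x $ j\<bar>\<close> has exactly the moments of
  \<open>\<mu>\<close> and is approximated from above by unconditional norms. Their
  \<open>p\<close>-th moments are only bounded below, so that these may be infinite; a limit is
  taken in the \<open>q\<close>-th moments alone.\<close>

lemma moment_constant_le:
  fixes C :: ennreal
  assumes \<mu>: "prob_space \<mu>" "sets \<mu> = sets borel" and q: "0 < q" "q \<le> p"
    and fin: "moment \<mu> abs q < \<infinity>"
    and C: "\<And>N :: real ^ 'n::finite \<Rightarrow> real. is_norm N \<Longrightarrow> unconditional N \<Longrightarrow>
      ennreal_powr (moment (power_measure \<mu>) N p) (1 / p)
        \<le> C * ennreal_powr (moment (power_measure \<mu>) N q) (1 / q)"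
  shows "moment_constant \<mu> p q \<le> C"
proof (cases "C = \<infinity>")
  case False
  fix j :: 'n
  have p: "0 < p" using q by simp
  have abs_meas [measurable]: "(\<lambda>x. \<bar>x\<bar> powr a) \<in> borel_measurable \<mu>" for a :: real
    by (simp add: measurable_cong_sets[OF \<mu>(2) refl])
  define N where "N e x = \<bar>x $ j\<bar> + e * (\<Sum>i\<in>UNIV. \<bar>x $ i\<bar>)" for e and x :: "real ^ 'n"
  have norm: "is_norm (N e)" if "0 < e" for e
    unfolding is_norm_def
  proof (intro conjI allI)
    show "0 \<le> N e x" for x using that by (simp add: N_def sum_nonneg)
    show "N e x = 0 \<longleftrightarrow> x = 0" for x
    proof
      assume "N e x = 0"
      then have "e * (\<Sum>i\<in>UNIV. \<bar>x $ i\<bar>) = 0"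
        using that by (simp add: N_def add_nonneg_eq_0_iff sum_nonneg)
      then show "x = 0" using that by (simp add: sum_nonneg_eq_0_iff vec_eq_iff)
    qed (simp add: N_def)
    show "N e (a *\<^sub>R x) = \<bar>a\<bar> * N e x" for a x
      by (simp add: N_def abs_mult sum_distrib_left algebra_simps)
    show "N e (x + y) \<le> N e x + N e y" for x y
    proof -
      have "(\<Sum>i\<in>UNIV. \<bar>(x + y) $ i\<bar>) \<le> (\<Sum>i\<in>UNIV. \<bar>x $ i\<bar>) + (\<Sum>i\<in>UNIV. \<bar>y $ i\<bar>)"
        by (simp add: sum.distrib[symmetric] sum_mono)
      from mult_left_mono[OF this, of e] show ?thesis
        using that abs_triangle_ineq[of "x $ j" "y $ j"] by (simp add: N_def algebra_simps)
    qed
  qed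
  have uncond: "unconditional (N e)" for e
  proof -
    have "\<bar>\<epsilon> i * x $ i\<bar> = \<bar>x $ i\<bar>" if "\<forall>i. \<epsilon> i \<in> {-1, 1}" for \<epsilon> :: "'n \<Rightarrow> real" and x :: "real ^ 'n" and i
      using that[rule_format, of i] by auto
    then show ?thesis by (auto simp: unconditional_def N_def)
  qed
  define e where "e n = 1 / real (Suc n)" for n
  have e: "0 < e n" "e n \<le> 1" for n by (simp_all add: e_def)
  have e_lim: "e \<longlonglongrightarrow> 0" unfolding e_def by (rule LIMSEQ_Suc[OF lim_1_over_n])
  obtain b where b: "0 \<le> b" "moment \<mu> abs q = ennreal b"
    using fin by (cases "moment \<mu> abs q") auto
  have mom_abs: "moment (power_measure \<mu>) (\<lambda>x :: real ^ 'n. \<bar>x $ j\<bar>) r = moment \<mu> abs r" for r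
    unfolding moment_def by (rule nn_integral_power_measure_component[OF \<mu>]) simp
  have N_meas: "(\<lambda>x. ennreal (N a x powr q)) \<in> borel_measurable (power_measure \<mu>)" for a
    unfolding N_def by (simp add: measurable_cong_sets[OF sets_power_measure refl])
  have dom_fin: "moment (power_measure \<mu>) (N 1) q < \<infinity>"
  proof -
    obtain K where "0 \<le> K" "moment (power_measure \<mu>) (N 1) q \<le> ennreal K * moment \<mu> abs q"
      by (rule moment_norm_le[OF norm \<mu> q(1)]) auto
    then show ?thesis using fin by (auto simp: ennreal_mult_less_top intro: le_less_trans)
  qed
  have N_mono: "N (e n) x \<le> N 1 x" for n x
    using e[of n] by (simp add: N_def mult_left_le_one_le sum_nonneg)
  have N_nonneg: "0 \<le> N (e n) x" for n x
    using e[of n] by (simp add: N_def sum_nonneg)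
  \<comment> \<open>Dominated convergence; since \<open>e n \<le> 1\<close>, the norm
    \<open>N 1\<close> is a majorant with finite \<open>q\<close>-th moment.\<close>
  have mom_lim: "(\<lambda>n. moment (power_measure \<mu>) (N (e n)) q) \<longlonglongrightarrow> moment \<mu> abs q"
    unfolding mom_abs[symmetric] unfolding moment_def
  proof (rule nn_integral_dominated_convergence[where w="\<lambda>x. ennreal (N 1 x powr q)"])
    show "AE x in power_measure \<mu>. ennreal (N (e n) x powr q) \<le> ennreal (N 1 x powr q)" for n
      using q N_mono N_nonneg by (intro AE_I2 ennreal_leI powr_mono2) auto
    show "AE x in power_measure \<mu>. (\<lambda>n. ennreal (N (e n) x powr q)) \<longlonglongrightarrow> ennreal (\<bar>x $ j\<bar> powr q)"
    proof (intro AE_I2 tendsto_ennrealI tendsto_powr')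
      fix x :: "real ^ 'n"
      have "(\<lambda>n. N (e n) x) \<longlonglongrightarrow> \<bar>x $ j\<bar> + 0 * (\<Sum>i\<in>UNIV. \<bar>x $ i\<bar>)"
        unfolding N_def by (intro tendsto_intros e_lim)
      then show "(\<lambda>n. N (e n) x) \<longlonglongrightarrow> \<bar>x $ j\<bar>" by simp
      show "\<bar>x $ j\<bar> \<noteq> 0 \<or> 0 < q \<and> (\<forall>\<^sub>F n in sequentially. 0 \<le> N (e n) x)"
        using q N_nonneg by simp
    qed simp
    show "(\<integral>\<^sup>+x. ennreal (N 1 x powr q) \<partial>power_measure \<mu>) < \<infinity>"
      using dom_fin by (simp add: moment_def)
  qed (use N_meas in \<open>simp_all add: measurable_cong_sets[OF sets_power_measure refl]\<close>)
  have root_lim: "(\<lambda>n. ennreal_powr (moment (power_measure \<mu>) (N (e n)) q) (1 / q)) \<longlonglongrightarrow> ennreal (b powr (1 / q))"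
  proof -
    define m where "m n = enn2real (moment (power_measure \<mu>) (N (e n)) q)" for n
    have "moment (power_measure \<mu>) (N (e n)) q < \<infinity>" for n
      using dom_fin N_mono N_nonneg q unfolding moment_def
      by (elim le_less_trans[rotated]) (intro nn_integral_mono ennreal_leI powr_mono2, auto)
    then have m: "moment (power_measure \<mu>) (N (e n)) q = ennreal (m n)" for n
      by (simp add: m_def)
    have m0: "0 \<le> m n" for n by (simp add: m_def)
    have "m \<longlonglongrightarrow> b"
      using mom_lim b m0 by (simp add: m)
    then have "(\<lambda>n. m n powr (1 / q)) \<longlonglongrightarrow> b powr (1 / q)"
      using q m0 by (intro tendsto_powr') auto
    then show ?thesis using m0 by (simp add: m ennreal_powr_ennreal)
  qed
  have "ennreal_powr (moment \<mu> abs p) (1 / p) \<le> C * ennreal (b powr (1 / q))"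
  proof (rule LIMSEQ_le_const)
    show "(\<lambda>n. C * ennreal_powr (moment (power_measure \<mu>) (N (e n)) q) (1 / q)) \<longlonglongrightarrow> C * ennreal (b powr (1 / q))"
      using False by (intro ennreal_tendsto_cmult root_lim) (simp add: top.not_eq_extremum)
    show "\<exists>K. \<forall>n\<ge>K. ennreal_powr (moment \<mu> abs p) (1 / p)
        \<le> C * ennreal_powr (moment (power_measure \<mu>) (N (e n)) q) (1 / q)"
    proof (intro exI allI impI)
      fix n
      have "moment \<mu> abs p \<le> moment (power_measure \<mu>) (N (e n)) p"
        unfolding mom_abs[symmetric] unfolding moment_def using p e[of n]
        by (intro nn_integral_mono ennreal_leI powr_mono2) (auto simp: N_def sum_nonneg)
      then have "ennreal_powr (moment \<mu> abs p) (1 / p)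
          \<le> ennreal_powr (moment (power_measure \<mu>) (N (e n)) p) (1 / p)"
        using p by (intro ennreal_powr_mono) auto
      also have "\<dots> \<le> C * ennreal_powr (moment (power_measure \<mu>) (N (e n)) q) (1 / q)"
        by (rule C[OF norm uncond]) (rule e)
      finally show "ennreal_powr (moment \<mu> abs p) (1 / p)
        \<le> C * ennreal_powr (moment (power_measure \<mu>) (N (e n)) q) (1 / q)" .
    qed
  qed
  \<comment> \<open>If \<open>b = 0\<close>, the bound forces the numerator to vanish, and the
    constant is \<open>0 / 0 = 0\<close>.\<close>
  then show ?thesis
    using b by (cases "b = 0")
      (auto simp: moment_constant_def ennreal_powr_ennreal mult.commute intro!: divide_le_posI_ennreal)
qed simp

theorem corollary2:
  fixes j :: "'n :: finite" and p q :: real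
  assumes "0 < q" and "q \<le> p"
  shows
    "(\<forall>\<mu> :: real measure.
        prob_space \<mu> \<and> sets \<mu> = sets borel \<and>
        supports_S_inequality_ideals j (power_measure \<mu>) \<and>
        moment \<mu> abs q < \<infinity> \<longrightarrow>
        (\<forall>N :: real ^ 'n \<Rightarrow> real. is_norm N \<and> unconditional N \<longrightarrow>
          ennreal_powr (moment (power_measure \<mu>) N p) (1 / p)
            \<le> moment_constant \<mu> p q * ennreal_powr (moment (power_measure \<mu>) N q) (1 / q)) \<and>
        (\<forall>C :: ennreal.
          (\<forall>N :: real ^ 'n \<Rightarrow> real. is_norm N \<and> unconditional N \<longrightarrow>
            ennreal_powr (moment (power_measure \<mu>) N p) (1 / p)
              \<le> C * ennreal_powr (moment (power_measure \<mu>) N q) (1 / q)) \<longrightarrow>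
          moment_constant \<mu> p q \<le> C)) \<and>
     (\<forall>\<mu> \<in> {nu r | r. 0 < r \<and> r \<le> 1} \<union> {omega \<alpha> | \<alpha>. 0 < \<alpha>} \<union> {lam s | s. 1 \<le> s}.
        prob_space \<mu> \<and> sets \<mu> = sets borel \<and>
        supports_S_inequality_ideals j (power_measure \<mu>) \<and>
        moment \<mu> abs q < \<infinity>)"
proof (intro conjI allI impI ballI)
  fix \<mu> :: "real measure" and N :: "real ^ 'n \<Rightarrow> real"
  assume "prob_space \<mu> \<and> sets \<mu> = sets borel \<and>
      supports_S_inequality_ideals j (power_measure \<mu>) \<and> moment \<mu> abs q < \<infinity>"
    and "is_norm N \<and> unconditional N"
  then show "ennreal_powr (moment (power_measure \<mu>) N p) (1 / p)
      \<le> moment_constant \<mu> p q * ennreal_powr (moment (power_measure \<mu>) N q) (1 / q)"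
    using moment_comparison assms by blast
next
  fix \<mu> :: "real measure" and C :: ennreal
  assume "prob_space \<mu> \<and> sets \<mu> = sets borel \<and>
      supports_S_inequality_ideals j (power_measure \<mu>) \<and> moment \<mu> abs q < \<infinity>"
    and "\<forall>N :: real ^ 'n \<Rightarrow> real. is_norm N \<and> unconditional N \<longrightarrow>
      ennreal_powr (moment (power_measure \<mu>) N p) (1 / p)
        \<le> C * ennreal_powr (moment (power_measure \<mu>) N q) (1 / q)"
  then show "moment_constant \<mu> p q \<le> C"
    using assms by (intro moment_constant_le[where 'n='n]) auto
next
  fix \<mu> assume "\<mu> \<in> {nu r | r. 0 < r \<and> r \<le> 1} \<union> {omega \<alpha> | \<alpha>. 0 < \<alpha>} \<union> {lam s | s. 1 \<le> s}"
  then obtain s r where s: "1 \<le> s" and r: "0 < r" and \<mu>: "\<mu> = density lborel (radial_density s r)"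
    by (rule radial_families)
  interpret gamma_shape s by unfold_locales (rule s)
  interpret gamma_radial s \<mu> r unfolding \<mu> by (rule gamma_radial_radial_density[OF r])
  show "prob_space \<mu>" by (rule prob_space_axioms)
  show "sets \<mu> = sets borel" by (rule sets_eq)
  show "supports_S_inequality_ideals j (power_measure \<mu>)"
    by (rule supports_S_inequality_ideals_power_measure)
  show "moment \<mu> abs q < \<infinity>"
    unfolding \<mu> by (rule moment_radial_density_finite[OF r assms(1)])
qed

end
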